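(* Let $R$ be a plane region with holes and let $G$ be a weighted, turn-bipartite symmetric planar graph embedded in $R$, with symmetry axis $\ell$ (taken horizontal) containing an even number $2\,\mathrm{w}(G)$ of vertices of $G$, and suppose all holes of $R$ lie along $\ell$. Let $G'$ be the graph constructed below. Then $$\mathrm{M}(G)=2^{\mathrm{w}(G)}\,\mathrm{M}(G').$$
   Context: A planar graph $G$ embedded in a region $R$ with holes is turn-bipartite if for every cycle $C$ of $G$, the length of $C$ has the same parity as the number of holes of $R$ lying in the interior of $C$. A plane graph is symmetric if it is invariant under reflection across a straight line $\ell$; it is weighted symmetric if in addition its edge weights are constant on orbits of the reflection. The width $\mathrm{w}(G)$ is half the number of vertices of $G$ on $\ell$; denote these vertices, from left to right, by $a_1,b_1,a_2,b_2,\dots,a_{\mathrm{w}(G)},b_{\mathrm{w}(G)}$. "Cutting above" a vertex $v$ on $\ell$ means deleting all edges incident to $v$ that lie above $\ell$; "cutting below" is defined analogously. Let $G_{\ge}$ be the subgraph of $G$ induced by the vertices on or above $\ell$; under the hypotheses (turn-bipartite, all holes along $\ell$) $G_{\ge}$ is bipartite. Colour its two bipartition classes black and white so that $a_1$ is white. The graph $G'$ is obtained from $G$ by cutting above every white $a_i$ and every black $b_i$, cutting below every black $a_i$ and every white $b_i$, and then halving the weight of each edge lying on $\ell$ (all other weights unchanged). $\mathrm{M}(H)$ denotes the sum over perfect matchings of $H$ of the product of the edge weights. *)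

theory Defs
  imports "HOL-Analysis.Analysis"
begin

section \<open>Weighted plane graphs\<close>

text \<open>
  The plane is the type of complex numbers. An edge is the point set of the arc that draws it,
  so that parallel edges are allowed (they are different point sets), while loops are not. Since
  an edge passes through no vertex other than its two ends, the set of ends of \<open>e\<close> is
  \<open>e \<inter> verts G\<close>, and \<open>v \<in> verts G\<close> is incident to \<open>e\<close> iff \<open>v \<in> e\<close>.
\<close>

record 'w wgraph =
  verts :: "complex set"
  edges :: "complex set set"
  weight :: "complex set \<Rightarrow> 'w"

definition plane_graph :: "'w wgraph \<Rightarrow> bool" where
  "plane_graph G \<longleftrightarrow>
     finite (verts G) \<and> finite (edges G) \<and>
     (\<forall>e\<in>edges G. \<exists>g. arc g \<and> path_image g = e \<and>
        e \<inter> verts G = {pathstart g, pathfinish g}) \<and>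
     (\<forall>e\<in>edges G. \<forall>f\<in>edges G. e \<noteq> f \<longrightarrow> e \<inter> f \<subseteq> verts G)"

definition induced_subgraph :: "'w wgraph \<Rightarrow> complex set \<Rightarrow> 'w wgraph" where
  "induced_subgraph G S =
     G\<lparr>verts := verts G \<inter> S, edges := {e \<in> edges G. e \<inter> verts G \<subseteq> S}\<rparr>"

definition bipartition :: "'w wgraph \<Rightarrow> complex set \<Rightarrow> complex set \<Rightarrow> bool" where
  "bipartition G W B \<longleftrightarrow>
     W \<union> B = verts G \<and> W \<inter> B = {} \<and> (\<forall>e\<in>edges G. e \<inter> W \<noteq> {} \<and> e \<inter> B \<noteq> {})"

definition perfect_matching :: "'w wgraph \<Rightarrow> complex set set \<Rightarrow> bool" where
  "perfect_matching G \<mu> \<longleftrightarrow> \<mu> \<subseteq> edges G \<and> (\<forall>v\<in>verts G. \<exists>!e. e \<in> \<mu> \<and> v \<in> e)"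

definition matching_sum :: "'w::comm_semiring_1 wgraph \<Rightarrow> 'w" where
  "matching_sum G = (\<Sum>\<mu> | perfect_matching G \<mu>. \<Prod>e\<in>\<mu>. weight G e)"

text \<open>
  A cycle is given by its cyclic sequences of vertices and edges; \<open>es ! i\<close> joins
  \<open>vs ! i\<close> to its cyclic successor. Two parallel edges form a cycle of length 2.
\<close>

definition cycle :: "'w wgraph \<Rightarrow> complex list \<Rightarrow> complex set list \<Rightarrow> bool" where
  "cycle G vs es \<longleftrightarrow>
     length vs = length es \<and> 2 \<le> length es \<and> distinct vs \<and> distinct es \<and> set es \<subseteq> edges G \<and>
     (\<forall>i<length es. es ! i \<inter> verts G = {vs ! i, vs ! (Suc i mod length es)})"


section \<open>Regions with holes and turn-bipartite graphs\<close>

definition holes :: "complex set \<Rightarrow> complex set set" where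
  "holes R = {H \<in> components (- R). bounded H}"

text \<open>Neither openness nor closedness is required, so that both open domains and closed regions
  (such as unions of lattice cells) are covered; there may also be no holes.\<close>

definition region_with_holes :: "complex set \<Rightarrow> bool" where
  "region_with_holes R \<longleftrightarrow> connected R \<and> finite (holes R)"

definition embedded_in :: "'w wgraph \<Rightarrow> complex set \<Rightarrow> bool" where
  "embedded_in G R \<longleftrightarrow> verts G \<subseteq> R \<and> \<Union>(edges G) \<subseteq> R"

definition turn_bipartite :: "complex set \<Rightarrow> 'w wgraph \<Rightarrow> bool" where
  "turn_bipartite R G \<longleftrightarrow>
     (\<forall>vs es. cycle G vs es \<longrightarrow>
        even (length es) = even (card {H \<in> holes R. H \<subseteq> inside (\<Union>(set es))}))"


section \<open>Symmetric graphs\<close>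

text \<open>Throughout, the symmetry axis is the horizontal line at height \<open>h\<close>.\<close>

definition axis :: "real \<Rightarrow> complex set" where
  "axis h = {z. Im z = h}"

definition reflect :: "real \<Rightarrow> complex \<Rightarrow> complex" where
  "reflect h z = Complex (Re z) (2 * h - Im z)"

definition weighted_symmetric :: "real \<Rightarrow> 'w wgraph \<Rightarrow> bool" where
  "weighted_symmetric h G \<longleftrightarrow>
     reflect h ` verts G = verts G \<and>
     (\<lambda>e. reflect h ` e) ` edges G = edges G \<and>
     (\<forall>e\<in>edges G. weight G (reflect h ` e) = weight G e)"

text \<open>A hole lies along the axis if it meets it; it need be neither centred on the axis nor
  symmetric.\<close>

definition holes_along :: "real \<Rightarrow> complex set \<Rightarrow> bool" where
  "holes_along h R \<longleftrightarrow> (\<forall>H\<in>holes R. H \<inter> axis h \<noteq> {})"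

definition axis_verts :: "real \<Rightarrow> 'w wgraph \<Rightarrow> complex set" where
  "axis_verts h G = verts G \<inter> axis h"

definition width :: "real \<Rightarrow> 'w wgraph \<Rightarrow> nat" where
  "width h G = card (axis_verts h G) div 2"

text \<open>The vertices on the axis, listed from left to right, are
  \<open>a\<^sub>1, b\<^sub>1, a\<^sub>2, b\<^sub>2, \<dots>\<close>; the index of \<open>a_vert\<close> and \<open>b_vert\<close> starts at 1.\<close>

definition axis_list :: "real \<Rightarrow> 'w wgraph \<Rightarrow> complex list" where
  "axis_list h G = map (\<lambda>x. Complex x h) (sorted_list_of_set (Re ` axis_verts h G))"

definition a_vert :: "real \<Rightarrow> 'w wgraph \<Rightarrow> nat \<Rightarrow> complex" where
  "a_vert h G i = axis_list h G ! (2 * i - 2)"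

definition b_vert :: "real \<Rightarrow> 'w wgraph \<Rightarrow> nat \<Rightarrow> complex" where
  "b_vert h G i = axis_list h G ! (2 * i - 1)"


section \<open>The cut graph\<close>

definition upper_subgraph :: "real \<Rightarrow> 'w wgraph \<Rightarrow> 'w wgraph" where
  "upper_subgraph h G = induced_subgraph G {z. h \<le> Im z}"

text \<open>\<open>W\<close> and \<open>B\<close> are the white and the black class. If the upper subgraph is disconnected there
  are several such colourings. The condition on \<open>a\<^sub>1\<close> is void if the axis has no vertices.\<close>

definition upper_colouring :: "real \<Rightarrow> 'w wgraph \<Rightarrow> complex set \<Rightarrow> complex set \<Rightarrow> bool" where
  "upper_colouring h G W B \<longleftrightarrow>
     bipartition (upper_subgraph h G) W B \<and> (1 \<le> width h G \<longrightarrow> a_vert h G 1 \<in> W)"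

text \<open>An edge lies above (below) the axis if all its points other than its ends do.\<close>

definition cut_above :: "real \<Rightarrow> complex set \<Rightarrow> 'w wgraph \<Rightarrow> 'w wgraph" where
  "cut_above h S G = G\<lparr>edges :=
     {e \<in> edges G. \<not> (e \<inter> S \<noteq> {} \<and> e - verts G \<subseteq> {z. h < Im z})}\<rparr>"

definition cut_below :: "real \<Rightarrow> complex set \<Rightarrow> 'w wgraph \<Rightarrow> 'w wgraph" where
  "cut_below h S G = G\<lparr>edges :=
     {e \<in> edges G. \<not> (e \<inter> S \<noteq> {} \<and> e - verts G \<subseteq> {z. Im z < h})}\<rparr>"

definition halve_axis :: "real \<Rightarrow> 'w::field wgraph \<Rightarrow> 'w wgraph" where
  "halve_axis h G = G\<lparr>weight := \<lambda>e. if e \<subseteq> axis h then weight G e / 2 else weight G e\<rparr>"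

definition cut_graph ::
  "real \<Rightarrow> complex set \<Rightarrow> complex set \<Rightarrow> 'w::field wgraph \<Rightarrow> 'w wgraph" where
  "cut_graph h W B G =
     (let a = a_vert h G; b = b_vert h G; I = {1..width h G};
          above = {a i |i. i \<in> I \<and> a i \<in> W} \<union> {b i |i. i \<in> I \<and> b i \<in> B};
          below = {a i |i. i \<in> I \<and> a i \<in> B} \<union> {b i |i. i \<in> I \<and> b i \<in> W}
      in halve_axis h (cut_below h below (cut_above h above G)))"

end

theory Submission
  imports Defs
begin

text \<open>
  Let \<open>\<mu>\<close> be a perfect matching. The superposition of \<open>\<mu>\<close> and its mirror image splits into symmetric
  components, and each component that meets the axis contains exactly two axis vertices, joined by
  a path in the (folded) upper half-plane. These paths are disjoint, so by planarity they pair the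
  axis vertices without crossings, and an \<open>a\<close>-vertex is always paired with a \<open>b\<close>-vertex. Along a path
  both the colours and the sides of the edges of \<open>\<mu>\<close> alternate; hence \<open>\<mu>\<close> uses a cut edge at one end
  iff it does so at the other, and reflecting \<open>\<mu>\<close> in this component alone changes the answer unless
  the path is a single edge on the axis. So each perfect matching that uses no cut edge stands for
  \<open>2 ^ (w - k)\<close> perfect matchings of the same weight, where \<open>k\<close> is the number of its edges on the axis,
  and halving the weights of the latter accounts for the missing factor \<open>2 ^ k\<close>.

  The upper half is bipartite because a hole that meets the axis is not inside a cycle drawn in the
  closed upper half-plane.
\<close>


text \<open>That the two ends of a path agree is a count of parities. A cut edge at an axis vertex
  is recognised by the parity of the vertex's position on the axis, by its colour and by the side of
  the edge. From one end of a path with \<open>m\<close> edges to the other, the position changes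
  parity once, the colour changes \<open>m\<close> times and the side \<open>m - 1\<close> times: an
  even number in all. Planarity enters only through the position, since a noncrossing pairing leaves
  an even number of axis vertices between partners.

  The matching is not symmetric, so colours below the axis and disjointness of components are read
  off after folding the lower half-plane up. Two kinds of edges need care. An edge with both ends on
  the axis may be drawn below it, where the hypothesis on holes is not directly usable. An edge may
  also cross the axis, joining a vertex to its own mirror image; its ends fold to one vertex, so
  colours need not alternate along it. Such an edge never occurs in a component that contains an
  axis vertex.\<close>

section \<open>Two involutions\<close>

text \<open>Let \<open>n\<close> be the period of \<open>z\<close>. Since \<open>s\<close> fixes \<open>x\<close>, it maps \<open>z k\<close> to \<open>z (n - k)\<close>, and \<open>p\<close> maps
  \<open>z k\<close> to \<open>z (n - k - 1)\<close>; as \<open>p\<close> has no fixed point, \<open>n\<close> is even, and \<open>z (n div 2)\<close> is the other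
  fixed point of \<open>s\<close>.\<close>

lemma two_involutions_orbit:
  fixes p s :: "'a \<Rightarrow> 'a" and z :: "nat \<Rightarrow> 'a"
  assumes S: "finite S"
    and p: "\<And>v. v \<in> S \<Longrightarrow> p v \<in> S" "\<And>v. v \<in> S \<Longrightarrow> p (p v) = v" "\<And>v. v \<in> S \<Longrightarrow> p v \<noteq> v"
    and s: "\<And>v. v \<in> S \<Longrightarrow> s v \<in> S" "\<And>v. v \<in> S \<Longrightarrow> s (s v) = v"
    and x: "x \<in> S" "s x = x"
    and z0: "z 0 = x" and zSuc: "\<And>k. z (Suc k) = s (p (z k))"
  obtains m where "0 < m" "s (z m) = z m" "z m \<noteq> x"
    "\<And>k. 0 < k \<Longrightarrow> k < m \<Longrightarrow> s (z k) \<noteq> z k"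
    "\<And>v. v \<in> range z \<Longrightarrow> s v = v \<Longrightarrow> v = x \<or> v = z m"
    "\<And>v. v \<in> range z \<Longrightarrow> s v \<in> range z"
    "\<And>v. v \<in> range z \<Longrightarrow> p v \<in> range z"
proof -
  have zS: "z k \<in> S" for k
    by (induction k) (auto simp: z0 zSuc p s x)
  have inj: "u = v" if "s (p u) = s (p v)" "u \<in> S" "v \<in> S" for u v
    using that p s by metis
  \<comment> \<open>Since \<open>s \<circ> p\<close> is injective on \<open>S\<close>, a repetition
    anywhere in the sequence can be pulled back to index 0.\<close>
  have cancel: "z d = x" if "z (i + d) = z i" for i d
    using that
  proof (induction i)
    case (Suc i)
    then show ?case
      using inj[of "z (i + d)" "z i"] zS by (simp add: zSuc)
  qed (simp add: z0)
  have "\<not> inj z"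
    using finite_imageD[of z UNIV] zS S by (metis finite_subset image_subsetI infinite_UNIV_nat)
  then obtain i j where ij: "z i = z j" "i < j"
    unfolding inj_def by (metis nat_neq_iff)
  then have "z (j - i) = x" "0 < j - i"
    using cancel[of i "j - i"] by simp_all
  define n where "n = (LEAST n. 0 < n \<and> z n = x)"
  have n: "0 < n" "z n = x"
    using LeastI[of "\<lambda>n. 0 < n \<and> z n = x" "j - i"] \<open>z (j - i) = x\<close> \<open>0 < j - i\<close>
    by (auto simp: n_def)
  have n_least: "n \<le> d" if "0 < d" "z d = x" for d
    unfolding n_def using that by (simp add: Least_le)
  have z_inj: "i = j" if "z i = z j" "i < n" "j < n" for i j
  proof (rule ccontr)
    assume "i \<noteq> j"
    then consider "i < j" | "j < i" by linarith
    then show False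
    proof cases
      case 1
      then have "z (j - i) = x" using that cancel[of i "j - i"] by simp
      then show False using n_least[of "j - i"] 1 that by simp
    next
      case 2
      then have "z (i - j) = x" using that cancel[of j "i - j"] by simp
      then show False using n_least[of "i - j"] 2 that by simp
    qed
  qed
  have sz: "s (z (n - k)) = z k" if "k \<le> n" for k
    using that
  proof (induction k)
    case 0
    then show ?case by (simp add: n x z0)
  next
    case (Suc k)
    then have k: "n - k = Suc (n - Suc k)" by simp
    have "s (z (n - k)) = p (z (n - Suc k))"
      unfolding k zSuc using s(2) p(1) zS by blast
    with Suc have "p (z (n - Suc k)) = z k" by simp
    then have "z (n - Suc k) = p (z k)"
      using p(2)[OF zS] by metis
    then show ?case by (simp add: zSuc)
  qed
  have pz: "p (z k) = z (n - Suc k)" if "k < n" for k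
  proof -
    have "s (z (Suc k)) = p (z k)"
      unfolding zSuc using s(2) p(1) zS by blast
    then show ?thesis
      using sz[of "n - Suc k"] that by simp
  qed
  have "even n"
  proof (rule ccontr)
    assume "odd n"
    then obtain k where k: "n = Suc (2 * k)" by (metis oddE Suc_eq_plus1)
    then have "p (z k) = z k" using pz[of k] by simp
    with p(3)[OF zS] show False by blast
  qed
  then obtain m where m: "n = 2 * m" by blast
  have period: "z (k + n) = z k" for k
    by (induction k) (auto simp: n z0 zSuc)
  have zmod: "z k = z (k mod n)" for k
  proof (induction k rule: less_induct)
    case (less k)
    show ?case
    proof (cases "k < n")
      case False
      then have "z k = z (k - n)" using period[of "k - n"] by simp
      also have "\<dots> = z ((k - n) mod n)" using less[of "k - n"] False n by simp
      finally show ?thesis using False by (simp add: le_mod_geq)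
    qed simp
  qed
  have range: "\<exists>k<n. v = z k" if "v \<in> range z" for v
    using that zmod n by (metis imageE mod_less_divisor)
  have fix_k: "k = 0 \<or> k = m" if "k < n" "s (z k) = z k" for k
  proof (cases "k = 0")
    case False
    have "z (n - k) = z k"
      using sz[of "n - k"] that by simp
    then have "n - k = k"
      using z_inj[of "n - k" k] that False by simp
    then show ?thesis using m that(1) by arith
  qed simp
  show thesis
  proof (rule that[of m])
    show "0 < m" using n m by simp
    show "s (z m) = z m" using sz[of m] m by simp
    show "z m \<noteq> x" using n_least[of m] n m by auto
    show "s (z k) \<noteq> z k" if "0 < k" "k < m" for k
      using fix_k[of k] that m by auto
    show "v = x \<or> v = z m" if "v \<in> range z" "s v = v" for v
      using range[OF that(1)] that(2) fix_k z0 by metis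
    show "s v \<in> range z" if "v \<in> range z" for v
      using range[OF that] sz[of "n - k" for k] by (metis diff_diff_cancel diff_le_self less_imp_le rangeI)
    show "p v \<in> range z" if "v \<in> range z" for v
      using range[OF that] pz by (metis rangeI)
  qed
qed


section \<open>Graphs without odd cycles\<close>

text \<open>A shortest odd closed walk repeats no vertex: a repetition splits it into two shorter
  closed walks, and one of them is odd.\<close>

lemma odd_closed_walk_imp_odd_cycle:
  assumes walk: "(R ^^ n) u u" and "odd n"
  obtains vs where "odd (length vs)" "distinct vs"
    "\<And>i. i < length vs \<Longrightarrow> R (vs ! i) (vs ! (Suc i mod length vs))"
proof -
  let ?P = "\<lambda>n. odd n \<and> (\<exists>u. (R ^^ n) u u)"
  define k where "k = (LEAST n. ?P n)"
  have "?P k"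
    unfolding k_def using assms by (intro LeastI[of ?P n]) blast
  have least: "k \<le> n" if "?P n" for n
    unfolding k_def using that by (rule Least_le)
  obtain u f where f: "f 0 = u" "f k = u" "\<And>i. i < k \<Longrightarrow> R (f i) (f (Suc i))"
    using \<open>?P k\<close> unfolding relpowp_fun_conv by blast
  have sub: "(R ^^ (j - i)) (f i) (f j)" if "i \<le> j" "j \<le> k" for i j
    unfolding relpowp_fun_conv using that f(3)
    by (intro exI[of _ "\<lambda>l. f (i + l)"]) auto
  have "f i \<noteq> f j" if "i < j" "j < k" for i j
  proof
    assume eq: "f i = f j"
    have 1: "(R ^^ (j - i)) (f i) (f i)"
      using sub[of i j] that eq by simp
    have 2: "(R ^^ (i + (k - j))) u u"
      unfolding relpowp_add using sub[of 0 i] sub[of j k] that eq f(1,2) by (auto intro!: relcomppI)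
    have "odd (j - i) \<or> odd (i + (k - j))"
    proof -
      have "(j - i) + (i + (k - j)) = k" using that by simp
      then show ?thesis using \<open>?P k\<close> by (metis even_add)
    qed
    then show False
    proof
      assume "odd (j - i)"
      then have "k \<le> j - i" using least 1 by blast
      then show False using that by simp
    next
      assume "odd (i + (k - j))"
      then have "k \<le> i + (k - j)" using least 2 by blast
      then show False using that by simp
    qed
  qed
  then have inj: "inj_on f {0..<k}"
    by (metis atLeastLessThan_iff linorder_inj_onI')
  show thesis
  proof (rule that[of "map f [0..<k]"])
    show "distinct (map f [0..<k])" using inj by (simp add: distinct_map)
    fix i assume i: "i < length (map f [0..<k])"
    then have "f (Suc i mod k) = f (Suc i)"
      using f by (cases "Suc i = k") auto
    then show "R (map f [0..<k] ! i) (map f [0..<k] ! (Suc i mod length (map f [0..<k])))"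
      using i f(3) by simp
  qed (use \<open>?P k\<close> in simp)
qed

text \<open>The colour of a vertex is the parity of a walk to it from a representative of its
  component. Walks of both parities to one vertex would close up to an odd closed walk.\<close>

lemma no_odd_cycle_imp_two_colourable:
  assumes sym: "\<And>u v. R u v \<Longrightarrow> R v u"
    and no_odd: "\<And>vs. distinct vs \<Longrightarrow> (\<And>i. i < length vs \<Longrightarrow> R (vs ! i) (vs ! (Suc i mod length vs)))
      \<Longrightarrow> even (length vs)"
  obtains f :: "'a \<Rightarrow> bool" where "\<And>u v. R u v \<Longrightarrow> f u \<noteq> f v"
proof -
  have closed_even: "even n" if "(R ^^ n) u u" for n u
    using odd_closed_walk_imp_odd_cycle[OF that] no_odd by metis
  have pow_sym: "(R ^^ n) v u" if "(R ^^ n) u v" for n u v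
    using that
  proof (induction n arbitrary: v)
    case (Suc n)
    then obtain w where "(R ^^ n) u w" "R w v" by auto
    then have "(R ^^ n) w u" "R v w" using Suc sym by auto
    then show ?case by (metis relpowp_Suc_I2)
  qed auto
  have rsym: "R\<^sup>*\<^sup>* v u" if "R\<^sup>*\<^sup>* u v" for u v
    using that pow_sym unfolding rtranclp_power by blast
  define r where "r = (\<lambda>u. SOME z. R\<^sup>*\<^sup>* u z)"
  have r: "R\<^sup>*\<^sup>* (r u) u" for u
    unfolding r_def using someI[of "R\<^sup>*\<^sup>* u" u] rsym by blast
  define f where "f = (\<lambda>u. \<exists>n. even n \<and> (R ^^ n) (r u) u)"
  show thesis
  proof (rule that[of f])
    fix u v assume uv: "R u v"
    \<comment> \<open>Adjacent vertices reach the same vertices, so the choice in \<open>r\<close>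
      gives them the same representative.\<close>
    have "R\<^sup>*\<^sup>* u = R\<^sup>*\<^sup>* v"
      using uv sym by (intro ext) (meson converse_rtranclp_into_rtranclp)
    then have ruv: "r v = r u" by (simp add: r_def)
    show "f u \<noteq> f v"
    proof (cases "f u")
      case True
      then obtain n where n: "even n" "(R ^^ n) (r u) u" by (auto simp: f_def)
      have "\<not> f v"
      proof
        assume "f v"
        then obtain m where m: "even m" "(R ^^ m) (r u) v" by (auto simp: f_def ruv)
        have "(R ^^ (Suc n + m)) v v"
          unfolding relpowp_add using n pow_sym[OF m(2)] m(2) pow_sym[OF n(2)] uv
          by (metis relcomppI relpowp_Suc_I relpowp_add add.commute)
        then show False using closed_even n m by fastforce
      qed
      with True show ?thesis by simp
    next
      case False
      obtain n where n: "(R ^^ n) (r u) u" using r[of u] unfolding rtranclp_power by blast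
      with False have "odd n" by (auto simp: f_def)
      have "(R ^^ Suc n) (r v) v" using n uv ruv by auto
      then have "f v" unfolding f_def using \<open>odd n\<close> by (intro exI[of _ "Suc n"]) auto
      with False show ?thesis by simp
    qed
  qed
qed


section \<open>Arcs and reflections in the plane\<close>

lemma reflect_reflect [simp]: "reflect h (reflect h z) = z"
  by (simp add: reflect_def complex_eq_iff)

lemma Im_reflect [simp]: "Im (reflect h z) = 2 * h - Im z"
  by (simp add: reflect_def)

lemma Re_reflect [simp]: "Re (reflect h z) = Re z"
  by (simp add: reflect_def)

lemma reflect_eq_iff: "reflect h z = w \<longleftrightarrow> z = reflect h w"
  by auto

lemma reflect_fix_iff: "reflect h z = z \<longleftrightarrow> z \<in> axis h"
  by (auto simp: axis_def complex_eq_iff)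

lemma reflect_image_image [simp]: "reflect h ` reflect h ` S = S"
  by (simp add: image_image)

lemma mem_reflect_image_iff: "z \<in> reflect h ` S \<longleftrightarrow> reflect h z \<in> S"
  by (metis imageE image_eqI reflect_reflect)

lemma continuous_on_reflect [continuous_intros]: "continuous_on S (reflect h)"
  unfolding reflect_def by (intro continuous_intros)

definition fold_up :: "real \<Rightarrow> complex \<Rightarrow> complex" where
  "fold_up h z = (if Im z < h then reflect h z else z)"

text \<open>The absolute value makes continuity across the axis evident.\<close>

lemma fold_up_altdef: "fold_up h z = Complex (Re z) (h + \<bar>Im z - h\<bar>)"
  by (simp add: fold_up_def complex_eq_iff)

lemma continuous_on_fold_up: "continuous_on S (fold_up h)"
  unfolding fold_up_altdef by (intro continuous_intros)

lemma fold_up_reflect [simp]: "fold_up h (reflect h z) = fold_up h z"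
  by (simp add: fold_up_altdef abs_minus_commute)

lemma fold_up_axis: "z \<in> axis h \<Longrightarrow> fold_up h z = z"
  by (simp add: fold_up_def axis_def)

lemma Im_fold_up: "h \<le> Im (fold_up h z)"
  by (simp add: fold_up_altdef)

lemma fold_up_eqD: "fold_up h z = fold_up h w \<Longrightarrow> w = z \<or> w = reflect h z"
  by (auto simp: fold_up_def split: if_splits) (metis reflect_reflect)

text \<open>Such a map is strictly increasing, and an increasing involution is the identity:
  \<open>f t < t\<close> or \<open>t < f t\<close> is reversed by applying \<open>f\<close> once
  more.\<close>

lemma continuous_inj_involution_unit_interval:
  fixes f :: "real \<Rightarrow> real"
  assumes cont: "continuous_on {0..1} f" and inj: "inj_on f {0..1}"
    and "f 0 = 0" "f 1 = 1"
    and invol: "\<And>t. t \<in> {0..1} \<Longrightarrow> f t \<in> {0..1} \<and> f (f t) = t"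
    and t: "t \<in> {0..1}"
  shows "f t = t"
proof -
  have mono: "f a < f b" if ab: "0 \<le> a" "a < b" "b \<le> 1" for a b
  proof -
    have fa: "f a \<ge> 0" and fb: "f b \<le> 1" using invol[of a] invol[of b] that by auto
    consider "a = 0" | "b = 1" | "0 < a" "b < 1" using ab by linarith
    then show ?thesis
    proof cases
      case 1
      have "f b \<noteq> f a" using inj_on_contraD[OF inj, of b a] ab by auto
      then show ?thesis using 1 assms(3) invol[of b] that by force
    next
      case 2
      have "f b \<noteq> f a" using inj_on_contraD[OF inj, of b a] ab by auto
      then show ?thesis using 2 assms(4) invol[of a] that by force
    next
      case 3
      have "f b < f 1" using inj_on_contraD[OF inj, of b 1] that 3 assms(4) fb by force
      have "(f 0 < f b \<and> f b < f 1)"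
        using \<open>f b < f 1\<close> inj_on_contraD[OF inj, of b 0] that 3 assms(3) invol[of b] by force
      \<comment> \<open>A continuous injection on \<open>{0..b}\<close> puts \<open>f a\<close>
        strictly between \<open>f 0\<close> and \<open>f b\<close>, and \<open>f 0 < f b\<close>
        fixes the direction.\<close>
      have c2: "continuous_on {0..b} f" using cont that by (auto intro: continuous_on_subset)
      have i2: "inj_on f {0..b}" using inj that by (auto intro: inj_on_subset)
      show ?thesis
        using continuous_inj_imp_mono[of 0 a b f] c2 i2 3 that \<open>f 0 < f b \<and> f b < f 1\<close> by auto
    qed
  qed
  have ft: "f t \<in> {0..1}" "f (f t) = t" using invol[OF t] by auto
  show ?thesis
    using mono[of t "f t"] mono[of "f t" t] t ft by force
qed

text \<open>Transported to the parameter interval along \<open>g\<close>, the reflection becomes a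
  continuous involution that fixes 0 and 1. It is therefore the identity, so every point of the arc
  is its own mirror image.\<close>

lemma arc_reflect_fixes_ends_imp_axis:
  assumes g: "arc g" and im: "reflect h ` path_image g = path_image g"
    and ends: "pathstart g \<in> axis h" "pathfinish g \<in> axis h"
  shows "path_image g \<subseteq> axis h"
proof -
  have gc: "continuous_on {0..1} g" and gi: "inj_on g {0..1}"
    using g by (auto simp: arc_def path_def)
  define k where "k = the_inv_into {0..1} g"
  have kc: "continuous_on (path_image g) k"
    unfolding k_def path_image_def using continuous_on_inv_into[OF gc] gi by (simp add: compact_Icc)
  have kg: "k (g t) = t" if "t \<in> {0..1}" for t
    unfolding k_def using gi that by (simp add: the_inv_into_f_f)
  have gk: "g (k z) = z" "k z \<in> {0..1}" if "z \<in> path_image g" for z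
    using that unfolding k_def path_image_def by (auto simp: kg[unfolded k_def])
  have r: "reflect h (g t) \<in> path_image g" if "t \<in> {0..1}" for t
    using that im by (auto simp: path_image_def)
  define f where "f = (\<lambda>t. k (reflect h (g t)))"
  have cf: "continuous_on {0..1} f"
    unfolding f_def
    by (rule continuous_on_compose2[OF kc continuous_on_compose2[OF continuous_on_reflect gc]])
      (use r in auto)
  have ff: "f t \<in> {0..1} \<and> f (f t) = t" if "t \<in> {0..1}" for t
    using gk[OF r[OF that]] kg[OF that] by (auto simp: f_def)
  have "f t = t" if "t \<in> {0..1}" for t
  proof (rule continuous_inj_involution_unit_interval[OF cf])
    show "inj_on f {0..1}" by (metis ff inj_on_inverseI)
    show "f 0 = 0" "f 1 = 1"
      using ends kg[of 0] kg[of 1]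
      by (simp_all add: f_def pathstart_def pathfinish_def flip: reflect_fix_iff)
  qed (use ff that in auto)
  then have "reflect h (g t) = g t" if "t \<in> {0..1}" for t
    using that gk[OF r[OF that]] by (metis f_def)
  then show ?thesis by (auto simp: path_image_def reflect_fix_iff)
qed

lemma arc_image_minus_ends:
  assumes "arc g"
  shows "path_image g - {pathstart g, pathfinish g} = g ` {0<..<1}"
proof -
  have "{0..1} - {0,1} = {0<..<1::real}" by auto
  then have "g ` {0<..<1} = g ` {0..1} - g ` {0,1}"
    using assms inj_on_image_set_diff[of g "{0..1}" "{0..1}" "{0,1}"] by (auto simp: arc_def)
  then show ?thesis by (simp add: path_image_def pathstart_def pathfinish_def)
qed

lemma arc_interior_subset_closed:
  assumes "arc g" "path_image g - {pathstart g, pathfinish g} \<subseteq> T" "closed T"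
  shows "path_image g \<subseteq> T"
proof -
  have "closure {0<..<1::real} = {0..1}" by simp
  then have "g ` {0..1} \<subseteq> T"
    using image_closure_subset[of "{0<..<1}" g T] assms
    by (auto simp: arc_image_minus_ends arc_def path_def)
  then show ?thesis by (simp add: path_image_def)
qed

text \<open>The straight ray leaving the half-plane shows that points on or below the axis lie in an
  unbounded component of the complement.\<close>

lemma inside_upper_halfplane_Im_gt:
  assumes C: "C \<subseteq> {z. h \<le> Im z}" and z: "z \<in> inside C"
  shows "h < Im z"
proof (rule ccontr)
  assume "\<not> h < Im z"
  define L where "L = {w. Re w = Re z \<and> Im w \<le> Im z}"
  have "convex L"
  proof -
    have "L = {w. Re w \<le> Re z} \<inter> {w. Re w \<ge> Re z} \<inter> {w. Im w \<le> Im z}" by (auto simp: L_def)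
    then show ?thesis
      by (simp add: convex_Int convex_halfspace_Im_le convex_halfspace_Re_le convex_halfspace_Re_ge)
  qed
  moreover have "z \<notin> C" using z by (simp add: inside_def)
  then have "L \<subseteq> - C" using C \<open>\<not> h < Im z\<close>
    by (auto simp: L_def) (metis complex_eq_iff le_less_trans linorder_not_less mem_Collect_eq
        order_antisym order_trans subsetD)
  moreover have "z \<in> L" by (simp add: L_def)
  ultimately have "L \<subseteq> connected_component_set (- C) z"
    by (simp add: connected_component_maximal convex_connected)
  then have "bounded L" using z bounded_subset by (auto simp: inside_def)
  then obtain b where b: "\<And>w. w \<in> L \<Longrightarrow> norm w \<le> b" by (auto simp: bounded_iff)
  define w where "w = Complex (Re z) (min (Im z) (- \<bar>b\<bar> - 1))"
  have "w \<in> L" by (simp add: L_def w_def)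
  then have "\<bar>Im w\<bar> \<le> b" using b abs_Im_le_cmod order_trans by blast
  then show False by (simp add: w_def split: if_splits)
qed

text \<open>This is the Fashoda theorem in a box that contains both paths and has its lower side,
  with all four end points, on the axis. The map \<open>v\<close> only passes from complex numbers
  to \<open>real^2\<close>.\<close>

lemma interlaced_upper_paths_meet:
  assumes S: "S \<subseteq> {z. h \<le> Im z}" and T: "T \<subseteq> {z. h \<le> Im z}"
    and xy: "path_component S x y" and zw: "path_component T z w"
    and ax: "x \<in> axis h" "y \<in> axis h" "z \<in> axis h" "w \<in> axis h"
    and lt: "Re x < Re z" "Re z < Re y" "Re y < Re w"
  shows "S \<inter> T \<noteq> {}"
proof -
  obtain f where f: "path f" "path_image f \<subseteq> S" "pathstart f = x" "pathfinish f = y"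
    using xy by (auto simp: path_component_def)
  obtain g where g: "path g" "path_image g \<subseteq> T" "pathstart g = z" "pathfinish g = w"
    using zw by (auto simp: path_component_def)
  have "bounded (path_image f \<union> path_image g)"
    using f g by (simp add: bounded_path_image)
  then obtain b where b: "\<And>u. u \<in> path_image f \<union> path_image g \<Longrightarrow> norm u \<le> b"
    unfolding bounded_iff by blast
  define v :: "complex \<Rightarrow> real^2" where "v = (\<lambda>z. \<chi> i. if i = 1 then Re z else Im z)"
  have v12: "v u $ 1 = Re u" "v u $ 2 = Im u" for u by (simp_all add: v_def)
  have v_inj: "u = u'" if "v u = v u'" for u u'
    using that by (metis complex_eqI v12)
  have "continuous_on X v" for X
    unfolding v_def
  proof (rule continuous_on_vec_lambda)
    show "continuous_on X (\<lambda>z. if i = 1 then Re z else Im z)" for i :: 2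
      by (cases "i = 1") (simp_all add: continuous_intros)
  qed
  then have pv: "path (v \<circ> f)" "path (v \<circ> g)"
    using f g by (auto intro: path_continuous_image)
  define lo hi :: "real^2" where "lo = vector [-b, h]" and "hi = vector [b, b]"
  have box: "v u \<in> cbox lo hi" if "u \<in> path_image f \<union> path_image g" for u
  proof -
    have "norm u \<le> b" "h \<le> Im u" using b that f g S T by auto
    then have "\<bar>Re u\<bar> \<le> b" "\<bar>Im u\<bar> \<le> b"
      using abs_Re_le_cmod abs_Im_le_cmod order_trans by blast+
    then show ?thesis
      using \<open>h \<le> Im u\<close> by (simp add: mem_box_cart forall_2 v12 lo_def hi_def) linarith
  qed
  obtain q where "q \<in> path_image (v \<circ> f)" "q \<in> path_image (v \<circ> g)"
  proof (rule fashoda_interlace[of "v \<circ> f" "v \<circ> g" lo hi])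
    show "path_image (v \<circ> f) \<subseteq> cbox lo hi" "path_image (v \<circ> g) \<subseteq> cbox lo hi"
      using box by (auto simp: path_image_compose)
  qed (use pv f g ax lt in \<open>auto simp: pathstart_compose pathfinish_compose v12 lo_def axis_def\<close>)
  then have "path_image f \<inter> path_image g \<noteq> {}"
    unfolding path_image_compose using v_inj by blast
  then show ?thesis using f g by blast
qed


section \<open>Edges of symmetric plane graphs\<close>

locale symmetric_plane_graph =
  fixes G :: "'w::field_char_0 wgraph" and h :: real
  assumes plane: "plane_graph G" and symmetric: "weighted_symmetric h G"
begin

abbreviation "V \<equiv> verts G"
abbreviation "E \<equiv> edges G"
abbreviation "\<sigma> \<equiv> reflect h"
abbreviation "A \<equiv> axis_verts h G"

definition above :: "complex set \<Rightarrow> bool" where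
  "above e \<longleftrightarrow> e - V \<subseteq> {z. h < Im z}"

definition below :: "complex set \<Rightarrow> bool" where
  "below e \<longleftrightarrow> e - V \<subseteq> {z. Im z < h}"

lemma finite_V: "finite V" and finite_E: "finite E"
  using plane by (auto simp: plane_graph_def)

lemma A_iff: "x \<in> A \<longleftrightarrow> x \<in> V \<and> \<sigma> x = x"
  by (simp add: axis_verts_def reflect_fix_iff)

lemma finite_A: "finite A"
  using finite_V by (simp add: axis_verts_def)

lemma edge_arc:
  assumes "e \<in> E"
  obtains g where "arc g" "path_image g = e" "e \<inter> V = {pathstart g, pathfinish g}"
    "e - V = path_image g - {pathstart g, pathfinish g}"
proof -
  obtain g where g: "arc g" "path_image g = e" "e \<inter> V = {pathstart g, pathfinish g}"
    using plane assms unfolding plane_graph_def by metis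
  then have "e - V = path_image g - {pathstart g, pathfinish g}"
    by (metis Diff_Int Diff_cancel Un_empty_left)
  with g show thesis using that by metis
qed

lemma edge_ends:
  assumes "e \<in> E"
  obtains u v where "e \<inter> V = {u, v}" "u \<noteq> v"
  using edge_arc[OF assms] arc_distinct_ends by metis

lemma edge_Int_subset: "e \<in> E \<Longrightarrow> f \<in> E \<Longrightarrow> e \<noteq> f \<Longrightarrow> e \<inter> f \<subseteq> V"
  using plane by (auto simp: plane_graph_def)

lemma reflect_in_V [simp]: "\<sigma> v \<in> V \<longleftrightarrow> v \<in> V"
  using symmetric by (metis weighted_symmetric_def mem_reflect_image_iff)

lemma reflect_in_E [simp]: "\<sigma> ` e \<in> E \<longleftrightarrow> e \<in> E"
  using symmetric by (metis (no_types, lifting) weighted_symmetric_def imageE image_eqI reflect_image_image)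

lemma weight_reflect: "e \<in> E \<Longrightarrow> weight G (\<sigma> ` e) = weight G e"
  using symmetric by (simp add: weighted_symmetric_def)

lemma reflect_edge_Int_V: "\<sigma> ` e \<inter> V = \<sigma> ` (e \<inter> V)"
  by (auto simp: mem_reflect_image_iff)

lemma edge_interior_nonempty:
  assumes "e \<in> E" shows "e - V \<noteq> {}"
proof -
  obtain g where g: "arc g" "e - V = path_image g - {pathstart g, pathfinish g}"
    using edge_arc[OF assms] by metis
  have "g ` {0<..<1} \<noteq> {}" by simp
  then show ?thesis using g arc_image_minus_ends by metis
qed

lemma connected_edge_interior:
  assumes "e \<in> E" shows "connected (e - V)"
proof -
  obtain g where g: "arc g" "e - V = path_image g - {pathstart g, pathfinish g}"
    using edge_arc[OF assms] by metis
  have "continuous_on {0<..<1} g"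
    using g(1) by (auto simp: arc_def path_def intro: continuous_on_subset)
  then show ?thesis
    using g arc_image_minus_ends connected_continuous_image by fastforce
qed

lemma above_imp_upper:
  assumes "e \<in> E" "above e" shows "e \<subseteq> {z. h \<le> Im z}"
proof -
  obtain g where g: "arc g" "path_image g = e"
    "e - V = path_image g - {pathstart g, pathfinish g}"
    using edge_arc[OF assms(1)] by metis
  have "path_image g - {pathstart g, pathfinish g} \<subseteq> {z. h \<le> Im z}"
    using assms(2) unfolding above_def g(3) by force
  then show ?thesis
    using arc_interior_subset_closed[OF g(1) _ closed_halfspace_Im_ge] g(2) by simp
qed

lemma below_imp_lower:
  assumes "e \<in> E" "below e" shows "e \<subseteq> {z. Im z \<le> h}"
proof -
  obtain g where g: "arc g" "path_image g = e"
    "e - V = path_image g - {pathstart g, pathfinish g}"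
    using edge_arc[OF assms(1)] by metis
  have "path_image g - {pathstart g, pathfinish g} \<subseteq> {z. Im z \<le> h}"
    using assms(2) unfolding below_def g(3) by force
  then show ?thesis
    using arc_interior_subset_closed[OF g(1) _ closed_halfspace_Im_le] g(2) by simp
qed

lemma above_reflect [simp]: "above (\<sigma> ` e) \<longleftrightarrow> below e"
proof -
  have "\<sigma> ` e - V = \<sigma> ` (e - V)" by (auto simp: mem_reflect_image_iff)
  then show ?thesis by (auto simp: above_def below_def)
qed

lemma below_reflect [simp]: "below (\<sigma> ` e) \<longleftrightarrow> above e"
  using above_reflect[of "\<sigma> ` e"] by simp

lemma subset_axis_reflect [simp]: "\<sigma> ` e \<subseteq> axis h \<longleftrightarrow> e \<subseteq> axis h"
  by (auto simp: axis_def)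

text \<open>An arc has points besides its ends, so no two of these conditions can hold vacuously
  together.\<close>

lemma side_exclusive:
  assumes "e \<in> E"
  shows "\<not> (above e \<and> below e)" "\<not> (above e \<and> e \<subseteq> axis h)" "\<not> (below e \<and> e \<subseteq> axis h)"
proof -
  obtain z where z: "z \<in> e - V" using edge_interior_nonempty[OF assms] by blast
  have "h < Im z" if "above e" using that z unfolding above_def by blast
  moreover have "Im z < h" if "below e" using that z unfolding below_def by blast
  moreover have "Im z = h" if "e \<subseteq> axis h" using that z unfolding axis_def by blast
  ultimately show "\<not> (above e \<and> below e)" "\<not> (above e \<and> e \<subseteq> axis h)" "\<not> (below e \<and> e \<subseteq> axis h)"
    by linarith+
qed

text \<open>An edge that meets the axis in an interior point is its own mirror image: it lies on the
  axis, or it joins a vertex off the axis to the mirror image of that vertex.\<close>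

lemma edge_cases:
  assumes e: "e \<in> E"
  obtains (axis) "e \<subseteq> axis h"
    | (crossing) u where "e \<inter> V = {u, \<sigma> u}" "u \<notin> axis h"
    | (above) "above e"
    | (below) "below e"
proof (cases "(e - V) \<inter> axis h = {}")
  case True
  have "above e \<or> below e"
  proof (rule ccontr)
    assume "\<not> (above e \<or> below e)"
    then obtain z w where zw: "z \<in> e - V" "w \<in> e - V" "Im z \<le> h" "h \<le> Im w"
      unfolding above_def below_def by (metis linorder_not_less mem_Collect_eq subsetI)
    have "connected (Im ` (e - V))"
      using connected_edge_interior[OF e] by (intro connected_continuous_image continuous_intros)
    then have "h \<in> Im ` (e - V)"
      using zw by (meson connectedD_interval image_eqI)
    then show False using True by (auto simp: axis_def)
  qed
  then show thesis using that by blast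
next
  case False
  then obtain q where q: "q \<in> e" "q \<notin> V" "q \<in> axis h" by blast
  \<comment> \<open>An interior point on the axis is shared by the edge and its mirror image;
    distinct edges share only vertices, so the two coincide. Reflection then either fixes both ends
    or swaps them.\<close>
  then have "q \<in> \<sigma> ` e" by (simp add: mem_reflect_image_iff flip: reflect_fix_iff)
  then have inv: "\<sigma> ` e = e"
    using edge_Int_subset[of "\<sigma> ` e" e] e q by auto
  obtain g where g: "arc g" "path_image g = e" "e \<inter> V = {pathstart g, pathfinish g}"
    using edge_arc[OF e] by metis
  define u v where "u = pathstart g" and "v = pathfinish g"
  have uv: "u \<noteq> v" "e \<inter> V = {u, v}"
    using g arc_distinct_ends[OF g(1)] by (simp_all add: u_def v_def)
  have "\<sigma> ` {u, v} = {u, v}" using reflect_edge_Int_V[of e] inv uv by simp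
  then consider "\<sigma> u = u" "\<sigma> v = v" | "\<sigma> u = v"
    by (auto simp: doubleton_eq_iff)
  then show thesis
  proof cases
    case 1
    then have "e \<subseteq> axis h"
      using arc_reflect_fixes_ends_imp_axis[OF g(1), of h] inv
      by (simp add: g(2) reflect_fix_iff u_def v_def)
    then show thesis using that by blast
  next
    case 2
    then show thesis using that(2)[of u] uv by (auto simp flip: reflect_fix_iff)
  qed
qed

text \<open>Whichever end \<open>v\<close> of a crossing edge is taken, the other end is the mirror
  image of \<open>v\<close>; so crossing edges can be excluded from knowledge at a single
  end.\<close>

lemma edge_cases_noncrossing:
  assumes e: "e \<in> E" and v: "v \<in> e" "v \<in> V" and ends: "e \<inter> V \<noteq> {v, \<sigma> v}"
  obtains (axis) "e \<subseteq> axis h" | (above) "above e" | (below) "below e"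
  using e
proof (cases rule: edge_cases)
  case (crossing u)
  then have "v = u \<or> v = \<sigma> u" using v by blast
  then have "{v, \<sigma> v} = {u, \<sigma> u}" by (metis insert_commute reflect_reflect)
  then show thesis using crossing ends by simp
qed (use that in auto)

lemma edge_at_axis_vertex_cases:
  assumes e: "e \<in> E" and v: "v \<in> e" "v \<in> A"
  obtains (axis) "e \<subseteq> axis h" | (above) "above e" | (below) "below e"
proof (rule edge_cases_noncrossing[of e v])
  show "e \<inter> V \<noteq> {v, \<sigma> v}"
    using edge_ends[OF e] v by (metis A_iff doubleton_eq_iff insert_absorb2)
  show "v \<in> V" using v by (simp add: A_iff)
qed (use e v that in blast)+

lemma noncrossing_edge_above:
  assumes e: "e \<in> E" and v: "v \<in> e" "v \<in> V" "h < Im v" and ends: "e \<inter> V \<noteq> {v, \<sigma> v}"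
  shows "above e"
  using e v(1,2) ends
proof (cases rule: edge_cases_noncrossing)
  case axis
  then show ?thesis using v by (auto simp: axis_def)
next
  case below
  then show ?thesis using below_imp_lower[OF e] v by auto
qed

lemma noncrossing_edge_below:
  assumes e: "e \<in> E" and v: "v \<in> e" "v \<in> V" "Im v < h" and ends: "e \<inter> V \<noteq> {v, \<sigma> v}"
  shows "below e"
  using e v(1,2) ends
proof (cases rule: edge_cases_noncrossing)
  case axis
  then show ?thesis using v by (auto simp: axis_def)
next
  case above
  then show ?thesis using above_imp_upper[OF e] v by auto
qed

text \<open>An edge with both ends in the closed upper half-plane may lie below the axis; its mirror
  image then has the same ends.\<close>

lemma upper_ends_imp_upper_edge:
  assumes e: "e \<in> E" and up: "e \<inter> V \<subseteq> {z. h \<le> Im z}"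
  obtains f where "f \<in> E" "f \<inter> V = e \<inter> V" "f \<subseteq> {z. h \<le> Im z}"
  using e
proof (cases rule: edge_cases)
  case axis
  then show thesis using that[of e] e by (auto simp: axis_def)
next
  case (crossing u)
  then have "h \<le> Im u" "h \<le> Im (\<sigma> u)" using up by blast+
  then show thesis using crossing by (simp add: axis_def)
next
  case above
  then show thesis using that[of e] e above_imp_upper by simp
next
  case below
  then have "e \<inter> V \<subseteq> axis h" using below_imp_lower[OF e] up by (force simp: axis_def)
  then have "\<sigma> ` (e \<inter> V) = e \<inter> V" by (force simp flip: reflect_fix_iff)
  then show thesis
    using that[of "\<sigma> ` e"] e below above_imp_upper[of "\<sigma> ` e"] by (simp add: reflect_edge_Int_V)
qed


section \<open>The upper half is bipartite\<close>

text \<open>The edge itself, not just its ends, must be drawn in the closed upper half-plane; only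
  then does a cycle stay where it cannot enclose a point of the axis.\<close>

definition upper_adj :: "complex \<Rightarrow> complex \<Rightarrow> bool" where
  "upper_adj u v \<longleftrightarrow> u \<noteq> v \<and> (\<exists>e\<in>E. e \<inter> V = {u, v} \<and> e \<subseteq> {z. h \<le> Im z})"

text \<open>Every hole contains a point of the axis, which is not inside the cycle. So the number of
  holes inside is 0, and turn-bipartiteness gives the parity of the length.\<close>

lemma upper_adj_cycle_even:
  assumes turn: "turn_bipartite R G" and along: "holes_along h R"
    and "distinct vs" and adj: "\<And>i. i < length vs \<Longrightarrow> upper_adj (vs ! i) (vs ! (Suc i mod length vs))"
  shows "even (length vs)"
proof -
  let ?n = "length vs"
  consider "?n = 0" | "?n = 1" | "?n = 2" | "3 \<le> ?n" by linarith
  then show ?thesis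
  proof cases
    case 2
    then show ?thesis using adj[of 0] by (simp add: upper_adj_def)
  next
    case 4
    obtain f where f: "\<And>i. i < ?n \<Longrightarrow> f i \<in> E \<and> f i \<inter> V = {vs ! i, vs ! (Suc i mod ?n)} \<and>
        f i \<subseteq> {z. h \<le> Im z}"
      using adj unfolding upper_adj_def by metis
    define es where "es = map f [0..<?n]"
    \<comment> \<open>Two positions with the same edge would be cyclic successors of each other,
      which is impossible for \<open>?n\<close> at least 3.\<close>
    have "inj_on f {0..<?n}"
    proof (rule inj_onI)
      fix i j assume ij: "i \<in> {0..<?n}" "j \<in> {0..<?n}" "f i = f j"
      then have eq: "{vs ! i, vs ! (Suc i mod ?n)} = {vs ! j, vs ! (Suc j mod ?n)}"
        using f[of i] f[of j] by simp
      have m: "Suc i mod ?n < ?n" "Suc j mod ?n < ?n"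
        by (rule mod_less_divisor, use 4 in linarith)+
      have "i = j \<or> (i = Suc j mod ?n \<and> j = Suc i mod ?n)"
        using eq ij m \<open>distinct vs\<close> by (auto simp: doubleton_eq_iff nth_eq_iff_index_eq)
      then show "i = j"
        using 4 ij by (auto simp: mod_Suc split: if_splits)
    qed
    then have "cycle G vs es"
      using 4 f \<open>distinct vs\<close> by (auto simp: cycle_def es_def distinct_map)
    moreover have "\<Union>(set es) \<subseteq> {z. h \<le> Im z}"
      using f by (fastforce simp: es_def)
    then have "\<not> H \<subseteq> inside (\<Union>(set es))" if "H \<in> holes R" for H
      using along that inside_upper_halfplane_Im_gt unfolding holes_along_def axis_def
      by (metis (mono_tags, lifting) Int_emptyI less_irrefl mem_Collect_eq subsetD)
    then have "{H \<in> holes R. H \<subseteq> inside (\<Union>(set es))} = {}" by blast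
    ultimately have "even (length es)"
      using turn[unfolded turn_bipartite_def, rule_format, of vs es] by (simp only: card.empty even_zero)
    then show ?thesis by (simp add: es_def)
  qed auto
qed

lemma upper_colouring_exists:
  assumes "turn_bipartite R G" "holes_along h R"
  shows "\<exists>W B. upper_colouring h G W B"
proof -
  obtain c :: "complex \<Rightarrow> bool" where c: "\<And>u v. upper_adj u v \<Longrightarrow> c u \<noteq> c v"
  proof (rule no_odd_cycle_imp_two_colourable[of upper_adj])
    show "upper_adj v u" if "upper_adj u v" for u v
      using that by (auto simp: upper_adj_def insert_commute)
  qed (use upper_adj_cycle_even[OF assms] in blast)+
  define a where "a = a_vert h G 1"
  define U where "U = V \<inter> {z. h \<le> Im z}"
  have ends: "\<exists>u v. e \<inter> U = {u, v} \<and> c u \<noteq> c v"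
    if e: "e \<in> E" "e \<inter> V \<subseteq> {z. h \<le> Im z}" for e
  proof -
    obtain f where f: "f \<in> E" "f \<inter> V = e \<inter> V" "f \<subseteq> {z. h \<le> Im z}"
      using upper_ends_imp_upper_edge[OF e] by metis
    obtain u v where uv: "e \<inter> V = {u, v}" "u \<noteq> v" using edge_ends[OF e(1)] by metis
    then have "upper_adj u v" using f by (auto simp: upper_adj_def)
    moreover have "e \<inter> U = e \<inter> V" using e by (auto simp: U_def)
    ultimately show ?thesis using c uv(1) by metis
  qed
  \<comment> \<open>White is the class of the leftmost axis vertex, whichever truth value
    \<open>c\<close> gives it.\<close>
  define W B where "W = {v \<in> U. c v = c a}" and "B = {v \<in> U. c v \<noteq> c a}"
  have "bipartition (upper_subgraph h G) W B"
    unfolding bipartition_def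
  proof (intro conjI ballI)
    fix e assume "e \<in> edges (upper_subgraph h G)"
    then have "e \<in> E" "e \<inter> V \<subseteq> {z. h \<le> Im z}"
      by (auto simp: upper_subgraph_def induced_subgraph_def)
    then obtain u v where uv: "e \<inter> U = {u, v}" "c u \<noteq> c v" using ends by metis
    then have "u \<in> e" "u \<in> U" "v \<in> e" "v \<in> U" by blast+
    then show "e \<inter> W \<noteq> {}" "e \<inter> B \<noteq> {}"
      using uv(2) unfolding W_def B_def by auto
  qed (auto simp: W_def B_def U_def upper_subgraph_def induced_subgraph_def)
  moreover have "a \<in> W" if "1 \<le> width h G"
  proof -
    have "finite (Re ` A)" "card (Re ` A) = card A"
      using finite_A by (auto simp: card_image inj_on_def axis_verts_def axis_def complex_eq_iff)
    then have "0 < length (axis_list h G)"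
      using that by (simp add: axis_list_def width_def)
    then have "a \<in> set (axis_list h G)"
      unfolding a_def a_vert_def by simp
    then have "a \<in> A"
      using finite_A by (auto simp: axis_list_def axis_verts_def axis_def complex_eq_iff)
    then show ?thesis by (auto simp: W_def U_def axis_verts_def axis_def)
  qed
  ultimately show ?thesis by (auto simp: upper_colouring_def a_def)
qed


section \<open>Orbits of a matching and of the reflection\<close>

definition medge :: "complex set set \<Rightarrow> complex \<Rightarrow> complex set" where
  "medge \<mu> v = (THE e. e \<in> \<mu> \<and> v \<in> e)"

definition partner :: "complex set set \<Rightarrow> complex \<Rightarrow> complex" where
  "partner \<mu> v = (THE u. u \<in> V \<and> u \<in> medge \<mu> v \<and> u \<noteq> v)"

context
  fixes \<mu> assumes pm: "perfect_matching G \<mu>"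
begin

lemma matching_subset: "\<mu> \<subseteq> E"
  using pm by (simp add: perfect_matching_def)

lemma finite_matching: "finite \<mu>"
  using matching_subset finite_E finite_subset by blast

lemma medge: "v \<in> V \<Longrightarrow> medge \<mu> v \<in> \<mu>" "v \<in> V \<Longrightarrow> v \<in> medge \<mu> v"
  using pm theI'[of "\<lambda>e. e \<in> \<mu> \<and> v \<in> e"] by (simp_all add: perfect_matching_def medge_def)

lemma medge_unique: "v \<in> V \<Longrightarrow> e \<in> \<mu> \<Longrightarrow> v \<in> e \<Longrightarrow> medge \<mu> v = e"
  using pm medge by (metis perfect_matching_def)

lemma medge_in_E: "v \<in> V \<Longrightarrow> medge \<mu> v \<in> E"
  using medge matching_subset by blast

lemma partner:
  assumes "v \<in> V"
  shows "medge \<mu> v \<inter> V = {v, partner \<mu> v}" "partner \<mu> v \<noteq> v" "partner \<mu> v \<in> V"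
proof -
  obtain a b where ab: "medge \<mu> v \<inter> V = {a, b}" "a \<noteq> b"
    using edge_ends[OF medge_in_E[OF assms]] by metis
  have "v \<in> {a, b}"
    using medge(2)[OF assms] assms unfolding ab(1)[symmetric] by blast
  then obtain u where u: "medge \<mu> v \<inter> V = {v, u}" "u \<noteq> v"
    using ab by (metis insertE insert_commute singletonD)
  have mem: "w \<in> V \<and> w \<in> medge \<mu> v \<longleftrightarrow> w \<in> {v, u}" for w
    unfolding u(1)[symmetric] by blast
  have "partner \<mu> v = u"
    unfolding partner_def
  proof (rule the_equality)
    show "u \<in> V \<and> u \<in> medge \<mu> v \<and> u \<noteq> v" using mem[of u] u(2) by simp
    show "w = u" if "w \<in> V \<and> w \<in> medge \<mu> v \<and> w \<noteq> v" for w
      using mem[of w] that by simp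
  qed
  then show "medge \<mu> v \<inter> V = {v, partner \<mu> v}" "partner \<mu> v \<noteq> v" "partner \<mu> v \<in> V"
    using u mem[of u] by simp_all
qed

lemma medge_partner: "v \<in> V \<Longrightarrow> medge \<mu> (partner \<mu> v) = medge \<mu> v"
  using partner[of v] medge(1)[of v] medge_unique[of "partner \<mu> v" "medge \<mu> v"]
  by (metis IntD1 insertI1 insert_commute)

lemma partner_partner: "v \<in> V \<Longrightarrow> partner \<mu> (partner \<mu> v) = v"
  using partner[of v] partner[of "partner \<mu> v"] medge_partner[of v]
  by (metis doubleton_eq_iff)

end

text \<open>Both conditions are reversible, as reflection is an involution and sharing an edge is
  symmetric. Hence such sets are stable under differences as well as unions, and a matching can be
  reflected inside one of them without disturbing the vertices outside.\<close>

definition closed_under :: "complex set set \<Rightarrow> complex set \<Rightarrow> bool" where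
  "closed_under \<mu> U \<longleftrightarrow> U \<subseteq> V \<and> \<sigma> ` U \<subseteq> U \<and> (\<forall>e\<in>\<mu>. e \<inter> U \<noteq> {} \<longrightarrow> e \<inter> V \<subseteq> U)"

lemma closed_under_V: "closed_under \<mu> V"
  by (auto simp: closed_under_def)

lemma closed_under_reflect: "closed_under \<mu> U \<Longrightarrow> \<sigma> v \<in> U \<longleftrightarrow> v \<in> U"
  unfolding closed_under_def by (metis image_subset_iff reflect_reflect)

lemma closed_under_edge:
  "closed_under \<mu> U \<Longrightarrow> e \<in> \<mu> \<Longrightarrow> v \<in> e \<Longrightarrow> v \<in> U \<Longrightarrow> w \<in> e \<Longrightarrow> w \<in> V \<Longrightarrow> w \<in> U"
  unfolding closed_under_def by blast

lemma closed_under_subset: "closed_under \<mu> U \<Longrightarrow> U \<subseteq> V"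
  by (simp add: closed_under_def)

lemma closed_underI:
  assumes "U \<subseteq> V" "\<And>v. v \<in> U \<Longrightarrow> \<sigma> v \<in> U"
    "\<And>e v w. e \<in> \<mu> \<Longrightarrow> v \<in> e \<Longrightarrow> v \<in> U \<Longrightarrow> w \<in> e \<Longrightarrow> w \<in> V \<Longrightarrow> w \<in> U"
  shows "closed_under \<mu> U"
  unfolding closed_under_def
proof (intro conjI ballI impI subsetI)
  fix e w assume "e \<in> \<mu>" "e \<inter> U \<noteq> {}" and w: "w \<in> e \<inter> V"
  then obtain v where "v \<in> e" "v \<in> U" by blast
  with \<open>e \<in> \<mu>\<close> w show "w \<in> U" using assms(3) by blast
qed (use assms in auto)

lemma closed_under_Union:
  assumes "\<And>U. U \<in> \<U> \<Longrightarrow> closed_under \<mu> U"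
  shows "closed_under \<mu> (\<Union>\<U>)"
proof (rule closed_underI)
  show "\<Union>\<U> \<subseteq> V" using assms closed_under_subset by blast
  show "\<sigma> v \<in> \<Union>\<U>" if "v \<in> \<Union>\<U>" for v
    using that assms closed_under_reflect by (metis Union_iff)
  show "w \<in> \<Union>\<U>" if "e \<in> \<mu>" "v \<in> e" "v \<in> \<Union>\<U>" "w \<in> e" "w \<in> V" for e v w
  proof -
    obtain U where U: "U \<in> \<U>" "v \<in> U" using \<open>v \<in> \<Union>\<U>\<close> by blast
    have "w \<in> U" using closed_under_edge[OF assms[OF U(1)]] that(1,2) U(2) that(4,5) .
    with U(1) show ?thesis by blast
  qed
qed

lemma closed_under_Diff:
  assumes U: "closed_under \<mu> U" and U': "closed_under \<mu> U'"
  shows "closed_under \<mu> (U - U')"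
proof (rule closed_underI)
  show "U - U' \<subseteq> V" using U closed_under_subset by blast
  show "\<sigma> v \<in> U - U'" if "v \<in> U - U'" for v
    using that closed_under_reflect[OF U] closed_under_reflect[OF U'] by blast
  show "w \<in> U - U'" if "e \<in> \<mu>" "v \<in> e" "v \<in> U - U'" "w \<in> e" "w \<in> V" for e v w
  proof
    show "w \<in> U" using closed_under_edge[OF U that(1,2) _ that(4,5)] that(3) by simp
    show "w \<notin> U'"
    proof
      assume "w \<in> U'"
      have "v \<in> V" using that(3) closed_under_subset[OF U] by blast
      then have "v \<in> U'" using closed_under_edge[OF U' that(1,4) \<open>w \<in> U'\<close> that(2)] by simp
      then show False using that(3) by simp
    qed
  qed
qed

text \<open>For a perfect matching this is the component of \<open>x\<close> in the superposition of \<open>\<mu>\<close> and its mirror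
  image, merged with the mirror image of that component.\<close>

definition orbit :: "complex set set \<Rightarrow> complex \<Rightarrow> complex set" where
  "orbit \<mu> x = \<Inter>{U. closed_under \<mu> U \<and> x \<in> U}"

lemma orbit_refl: "x \<in> orbit \<mu> x"
  by (simp add: orbit_def)

lemma orbit_minimal: "closed_under \<mu> U \<Longrightarrow> x \<in> U \<Longrightarrow> orbit \<mu> x \<subseteq> U"
  by (auto simp: orbit_def)

lemma closed_under_orbit:
  assumes "x \<in> V" shows "closed_under \<mu> (orbit \<mu> x)"
proof (rule closed_underI)
  show "orbit \<mu> x \<subseteq> V" using orbit_minimal[OF closed_under_V assms] .
  show "\<sigma> v \<in> orbit \<mu> x" if "v \<in> orbit \<mu> x" for v
    using that closed_under_reflect by (auto simp: orbit_def)
  show "w \<in> orbit \<mu> x" if "e \<in> \<mu>" "v \<in> e" "v \<in> orbit \<mu> x" "w \<in> e" "w \<in> V" for e v w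
    unfolding orbit_def
  proof
    fix U assume "U \<in> {U. closed_under \<mu> U \<and> x \<in> U}"
    then have U: "closed_under \<mu> U" "v \<in> U" using that(3) by (auto simp: orbit_def)
    then show "w \<in> U" using closed_under_edge[OF U(1) that(1,2) _ that(4,5)] by simp
  qed
qed

text \<open>If \<open>x\<close> were outside the orbit of \<open>z\<close>, removing that orbit from
  the orbit of \<open>x\<close> would leave a smaller closed set around \<open>x\<close>, against
  minimality.\<close>

lemma orbit_eq:
  assumes "x \<in> V" "z \<in> orbit \<mu> x" shows "orbit \<mu> z = orbit \<mu> x"
proof
  have cx: "closed_under \<mu> (orbit \<mu> x)" using closed_under_orbit[OF assms(1)] .
  then have z: "z \<in> V" using closed_under_subset assms(2) by blast
  then have cz: "closed_under \<mu> (orbit \<mu> z)" by (rule closed_under_orbit)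
  show "orbit \<mu> z \<subseteq> orbit \<mu> x" using orbit_minimal[OF cx assms(2)] .
  have "x \<in> orbit \<mu> z"
  proof (rule ccontr)
    assume "x \<notin> orbit \<mu> z"
    then have "orbit \<mu> x \<subseteq> orbit \<mu> x - orbit \<mu> z"
      using orbit_minimal[OF closed_under_Diff[OF cx cz]] orbit_refl by simp
    then show False using assms(2) orbit_refl by blast
  qed
  then show "orbit \<mu> x \<subseteq> orbit \<mu> z" by (rule orbit_minimal[OF cz])
qed

lemma orbit_disjoint:
  assumes "x \<in> V" "z \<in> V" "orbit \<mu> x \<noteq> orbit \<mu> z" shows "orbit \<mu> x \<inter> orbit \<mu> z = {}"
  using orbit_eq assms by (metis disjoint_iff)

text \<open>The two involutions are \<open>partner \<mu>\<close>, which has no fixed points, and the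
  reflection, whose fixed points are the axis vertices. The matching edge at \<open>z k\<close> ends
  at the mirror image of \<open>z (Suc k)\<close>, so after folding the vertices \<open>z 0\<close>,
  ..., \<open>z m\<close> are consecutive on a path.\<close>

lemma axis_orbit_path:
  assumes pm: "perfect_matching G \<mu>" and x: "x \<in> A"
    and z0: "z 0 = x" and zSuc: "\<And>k. z (Suc k) = \<sigma> (partner \<mu> (z k))"
  obtains m where "0 < m" "z m \<noteq> x" "orbit \<mu> x \<inter> A = {x, z m}"
    "\<And>k. 0 < k \<Longrightarrow> k < m \<Longrightarrow> z k \<notin> axis h" "range z = orbit \<mu> x"
proof -
  have xV: "x \<in> V" "\<sigma> x = x" using x by (auto simp: A_iff)
  obtain m where m: "0 < m" "\<sigma> (z m) = z m" "z m \<noteq> x"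
    "\<And>k. 0 < k \<Longrightarrow> k < m \<Longrightarrow> \<sigma> (z k) \<noteq> z k"
    "\<And>v. v \<in> range z \<Longrightarrow> \<sigma> v = v \<Longrightarrow> v = x \<or> v = z m"
    "\<And>v. v \<in> range z \<Longrightarrow> \<sigma> v \<in> range z"
    "\<And>v. v \<in> range z \<Longrightarrow> partner \<mu> v \<in> range z"
  proof (rule two_involutions_orbit[of V "partner \<mu>" \<sigma> x z])
    fix m
    assume "0 < m" "\<sigma> (z m) = z m" "z m \<noteq> x" "\<And>k. 0 < k \<Longrightarrow> k < m \<Longrightarrow> \<sigma> (z k) \<noteq> z k"
      "\<And>v. v \<in> range z \<Longrightarrow> \<sigma> v = v \<Longrightarrow> v = x \<or> v = z m"
      "\<And>v. v \<in> range z \<Longrightarrow> \<sigma> v \<in> range z"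
      "\<And>v. v \<in> range z \<Longrightarrow> partner \<mu> v \<in> range z"
    then show thesis by (rule that)
  qed (simp_all add: finite_V partner[OF pm] partner_partner[OF pm] xV z0 zSuc)
  have zV: "z k \<in> V" for k
    by (induction k) (use xV partner[OF pm] in \<open>auto simp: z0 zSuc\<close>)
  have "closed_under \<mu> (range z)"
  proof (rule closed_underI)
    show "range z \<subseteq> V" using zV by blast
    show "\<sigma> v \<in> range z" if "v \<in> range z" for v using m(6) that .
    fix e v w assume e: "e \<in> \<mu>" "v \<in> e" "v \<in> range z" "w \<in> e" "w \<in> V"
    then obtain k where k: "v = z k" by blast
    have "medge \<mu> v = e" using medge_unique[OF pm zV] e k by blast
    then have "e \<inter> V = {v, partner \<mu> v}" using partner(1)[OF pm zV] k by metis
    then have "w \<in> {v, partner \<mu> v}" using e by blast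
    then show "w \<in> range z" using m(7) e(3) by auto
  qed
  moreover have "x \<in> range z" using z0 by (metis rangeI)
  ultimately have "orbit \<mu> x \<subseteq> range z" using orbit_minimal by blast
  moreover have "z k \<in> orbit \<mu> x" for k
  proof (induction k)
    case (Suc k)
    have "partner \<mu> (z k) \<in> orbit \<mu> x"
      using closed_under_edge[OF closed_under_orbit[OF xV(1)] medge(1)[OF pm zV] medge(2)[OF pm zV] Suc]
        partner[OF pm zV] by blast
    then show ?case
      using closed_under_reflect[OF closed_under_orbit[OF xV(1)]] by (simp add: zSuc)
  qed (simp add: z0 orbit_refl)
  ultimately have range: "range z = orbit \<mu> x" by blast
  show thesis
  proof (rule that[OF m(1,3)])
    show "orbit \<mu> x \<inter> A = {x, z m}"
    proof
      show "orbit \<mu> x \<inter> A \<subseteq> {x, z m}"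
      proof
        fix v assume "v \<in> orbit \<mu> x \<inter> A"
        then have "v = x \<or> v = z m" using m(5)[of v] by (simp add: range A_iff)
        then show "v \<in> {x, z m}" by simp
      qed
      show "{x, z m} \<subseteq> orbit \<mu> x \<inter> A"
        using m(2) xV zV[of m] range orbit_refl by (auto simp: A_iff)
    qed
    show "z k \<notin> axis h" if "0 < k" "k < m" for k
      using m(4)[OF that] by (simp flip: reflect_fix_iff)
    show "range z = orbit \<mu> x" by fact
  qed
qed


section \<open>Planarity: paired axis vertices are separated by an even number of axis vertices\<close>

text \<open>A point set is enough for planarity, which needs only connections inside it and
  disjointness from other such sets; no explicit path has to be assembled.\<close>

definition folded_orbit :: "complex set set \<Rightarrow> complex \<Rightarrow> complex set" where
  "folded_orbit \<mu> x = fold_up h ` (\<Union>v\<in>orbit \<mu> x. medge \<mu> v)"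

lemma A_eqI: "x \<in> A \<Longrightarrow> y \<in> A \<Longrightarrow> Re x = Re y \<Longrightarrow> x = y"
  by (simp add: axis_verts_def axis_def complex_eq_iff)

text \<open>The orbit vertices whose folded positions can be reached from \<open>x\<close> form a
  closed set: mirror images fold to the same point, and a matching edge folds to a path-connected
  set. By minimality they are the whole orbit.\<close>

lemma path_component_folded_orbit:
  assumes pm: "perfect_matching G \<mu>" and x: "x \<in> A" and y: "y \<in> A" "y \<in> orbit \<mu> x"
  shows "path_component (folded_orbit \<mu> x) x y"
proof -
  let ?S = "folded_orbit \<mu> x"
  have xV: "x \<in> V" using x by (simp add: A_iff)
  note co = closed_under_orbit[OF xV, of \<mu>]
  define U where "U = {v \<in> orbit \<mu> x. path_component ?S x (fold_up h v)}"
  have "closed_under \<mu> U"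
  proof (rule closed_underI)
    show "U \<subseteq> V" using closed_under_subset[OF co] by (auto simp: U_def)
    show "\<sigma> v \<in> U" if "v \<in> U" for v
      using that closed_under_reflect[OF co] by (simp add: U_def)
    fix e v w assume e: "e \<in> \<mu>" "v \<in> e" "v \<in> U" "w \<in> e" "w \<in> V"
    then have v: "v \<in> orbit \<mu> x" "path_component ?S x (fold_up h v)" by (simp_all add: U_def)
    have vV: "v \<in> V" using v(1) closed_under_subset[OF co] by blast
    have eq: "medge \<mu> v = e" by (rule medge_unique[OF pm vV e(1,2)])
    obtain g where g: "arc g" "path_image g = e"
      using edge_arc[of e] matching_subset[OF pm] e(1) by (metis subsetD)
    have "path_connected (fold_up h ` e)"
      using g by (metis arc_imp_path path_connected_path_image path_connected_continuous_image
          continuous_on_fold_up)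
    moreover have "fold_up h ` e \<subseteq> ?S"
      using v(1) eq unfolding folded_orbit_def by blast
    ultimately have "path_component ?S (fold_up h v) (fold_up h w)"
      using e(2,4) unfolding path_connected_component
      by (meson imageI path_component_of_subset)
    then have "path_component ?S x (fold_up h w)" using v(2) path_component_trans by blast
    then show "w \<in> U"
      using closed_under_edge[OF co e(1,2) v(1) e(4,5)] by (simp add: U_def)
  qed
  moreover have "x \<in> ?S"
    unfolding folded_orbit_def using medge(2)[OF pm xV] orbit_refl[of x \<mu>] fold_up_axis[of x h] x
    by (metis (no_types, lifting) IntD2 UN_I axis_verts_def imageI)
  then have "x \<in> U"
    using orbit_refl x by (simp add: U_def fold_up_axis axis_verts_def path_component_refl)
  ultimately have "orbit \<mu> x \<subseteq> U" by (rule orbit_minimal)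
  then show ?thesis using y by (auto simp: U_def fold_up_axis axis_verts_def)
qed

text \<open>A common folded point lies on a matching edge of one orbit and on a matching edge of the
  other or its mirror image. These are distinct edges of the graph, so the point is a vertex, and it
  would belong to both orbits.\<close>

lemma folded_orbits_disjoint:
  assumes pm: "perfect_matching G \<mu>" and xz: "x \<in> V" "z \<in> V"
    and disj: "orbit \<mu> x \<inter> orbit \<mu> z = {}"
  shows "folded_orbit \<mu> x \<inter> folded_orbit \<mu> z = {}"
proof (rule ccontr)
  assume "folded_orbit \<mu> x \<inter> folded_orbit \<mu> z \<noteq> {}"
  then obtain v w a b where v: "v \<in> orbit \<mu> x" "a \<in> medge \<mu> v"
    and w: "w \<in> orbit \<mu> z" "b \<in> medge \<mu> w" and ab: "fold_up h a = fold_up h b"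
    unfolding folded_orbit_def by blast
  note cx = closed_under_orbit[OF xz(1), of \<mu>] and cz = closed_under_orbit[OF xz(2), of \<mu>]
  have vw: "v \<in> V" "w \<in> V"
    using v(1) w(1) closed_under_subset[OF cx] closed_under_subset[OF cz] by blast+
  have eV: "medge \<mu> v \<inter> V \<subseteq> orbit \<mu> x"
    using closed_under_edge[OF cx medge[OF pm vw(1)] v(1)] by blast
  have fV: "medge \<mu> w \<inter> V \<subseteq> orbit \<mu> z"
    using closed_under_edge[OF cz medge[OF pm vw(2)] w(1)] by blast
  \<comment> \<open>The mirror image of a matching edge need not be in \<open>\<mu>\<close>, but it
    is an edge of the graph with ends in the same orbit.\<close>
  have "\<exists>f\<in>E. a \<in> f \<and> f \<inter> V \<subseteq> orbit \<mu> z"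
  proof -
    have "b = a \<or> b = \<sigma> a" using fold_up_eqD[OF ab] .
    then show ?thesis
    proof
      assume "b = a"
      then show ?thesis using w(2) fV medge_in_E[OF pm vw(2)] by blast
    next
      assume b: "b = \<sigma> a"
      have "\<sigma> ` medge \<mu> w \<inter> V \<subseteq> orbit \<mu> z"
        unfolding reflect_edge_Int_V using fV closed_under_reflect[OF cz] by blast
      moreover have "a \<in> \<sigma> ` medge \<mu> w" using w(2) b by (simp add: mem_reflect_image_iff)
      ultimately show ?thesis using medge_in_E[OF pm vw(2)] reflect_in_E by blast
    qed
  qed
  then obtain f where f: "f \<in> E" "a \<in> f" "f \<inter> V \<subseteq> orbit \<mu> z" by blast
  have "v \<in> medge \<mu> v \<inter> V" using medge[OF pm vw(1)] vw by blast
  then have "medge \<mu> v \<noteq> f" using eV f(3) disj by blast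
  then have "a \<in> V" using edge_Int_subset[OF medge_in_E[OF pm vw(1)] f(1)] v(2) f(2) by blast
  then have "a \<in> orbit \<mu> x" "a \<in> orbit \<mu> z" using eV fV v(2) f(2,3) by blast+
  then show False using disj by blast
qed

lemma axis_orbits_noncrossing:
  assumes pm: "perfect_matching G \<mu>"
    and xy: "orbit \<mu> x \<inter> A = {x, y}" and zw: "orbit \<mu> z \<inter> A = {z, w}"
    and disj: "orbit \<mu> x \<inter> orbit \<mu> z = {}"
    and lt: "Re x < Re z" "Re z < Re y"
  shows "Re x < Re w" "Re w < Re y"
proof -
  have A: "x \<in> A" "y \<in> A" "z \<in> A" "w \<in> A" "y \<in> orbit \<mu> x" "w \<in> orbit \<mu> z"
    using xy zw by blast+
  then have V: "x \<in> V" "z \<in> V" and axis: "x \<in> axis h" "y \<in> axis h" "z \<in> axis h" "w \<in> axis h"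
    by (auto simp: axis_verts_def)
  have up: "folded_orbit \<mu> v \<subseteq> {z. h \<le> Im z}" for v
    using Im_fold_up by (auto simp: folded_orbit_def)
  note pc = path_component_folded_orbit[OF pm A(1,2,5)] path_component_folded_orbit[OF pm A(3,4,6)]
  note empty = folded_orbits_disjoint[OF pm V disj]
  have "w \<noteq> x" "w \<noteq> y" using A disj orbit_refl[of x \<mu>] by blast+
  then have ne: "Re w \<noteq> Re x" "Re w \<noteq> Re y" using A_eqI A by blast+
  have "\<not> Re y < Re w"
    using interlaced_upper_paths_meet[OF up up pc axis lt] empty by blast
  \<comment> \<open>With \<open>w\<close> to the left of \<open>x\<close>, the order is
    \<open>w\<close>, \<open>x\<close>, \<open>z\<close>, \<open>y\<close>, so the roles of the two
    paths are exchanged and one is reversed.\<close>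
  moreover have "\<not> Re w < Re x"
    using interlaced_upper_paths_meet[OF up up path_component_sym[OF pc(2)] pc(1)
        axis(4,3,1,2) _ lt] empty by blast
  ultimately show "Re x < Re w" "Re w < Re y" using ne by linarith+
qed

lemma axis_orbit:
  assumes "perfect_matching G \<mu>" "x \<in> A"
  obtains y where "orbit \<mu> x \<inter> A = {x, y}" "x \<noteq> y"
proof -
  define z where "z = (\<lambda>k. ((\<sigma> \<circ> partner \<mu>) ^^ k) x)"
  have z: "z 0 = x" "z (Suc k) = \<sigma> (partner \<mu> (z k))" for k by (simp_all add: z_def)
  show thesis
    by (rule axis_orbit_path[OF assms z], rule that) auto
qed

lemma axis_matching_edge_orbit:
  assumes pm: "perfect_matching G \<mu>" and x: "x \<in> A" and axis: "medge \<mu> x \<subseteq> axis h"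
  shows "orbit \<mu> x \<inter> A = medge \<mu> x \<inter> V"
proof -
  have xV: "x \<in> V" using x by (simp add: A_iff)
  obtain y where y: "orbit \<mu> x \<inter> A = {x, y}" using axis_orbit[OF pm x] by metis
  note p = partner[OF pm xV]
  have pe: "partner \<mu> x \<in> medge \<mu> x" using p(1) by blast
  then have "partner \<mu> x \<in> A" using axis p(3) by (auto simp: axis_verts_def)
  moreover have "partner \<mu> x \<in> orbit \<mu> x"
    using closed_under_edge[OF closed_under_orbit[OF xV] medge[OF pm xV] orbit_refl pe p(3)] .
  ultimately have "partner \<mu> x \<in> {x, y}" unfolding y[symmetric] by blast
  then show ?thesis using p(1,2) y by auto
qed

lemma card_axis_orbit:
  assumes "perfect_matching G \<mu>" "x \<in> A" shows "card (orbit \<mu> x \<inter> A) = 2"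
  using axis_orbit[OF assms] by (metis card_2_iff)

text \<open>Positions count from 0, so even positions belong to the \<open>a\<close>-vertices and
  odd ones to the \<open>b\<close>-vertices.\<close>

definition axis_index :: "complex \<Rightarrow> nat" where
  "axis_index x = card {z \<in> A. Re z < Re x}"

text \<open>By noncrossing, an orbit with one axis vertex strictly between \<open>x\<close> and
  \<open>y\<close> has both of its axis vertices there, so these vertices split into pairs.\<close>

lemma even_card_between:
  assumes pm: "perfect_matching G \<mu>" and xy: "orbit \<mu> x \<inter> A = {x, y}"
  shows "even (card {z \<in> A. Re x < Re z \<and> Re z < Re y})"
proof -
  let ?K = "{z \<in> A. Re x < Re z \<and> Re z < Re y}"
  let ?C = "(\<lambda>z. orbit \<mu> z \<inter> A) ` ?K"
  have x: "x \<in> V" using xy by (auto simp: A_iff)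
  have KV: "z \<in> V" if "z \<in> ?K" for z using that by (simp add: A_iff)
  have sub: "orbit \<mu> z \<inter> A \<subseteq> ?K" if z: "z \<in> ?K" for z
  proof -
    obtain w where w: "orbit \<mu> z \<inter> A = {z, w}" using axis_orbit[OF pm] z by blast
    have "z \<notin> orbit \<mu> x \<inter> A" using z unfolding xy by auto
    then have "orbit \<mu> x \<noteq> orbit \<mu> z" using z orbit_refl[of z \<mu>] by auto
    then have "orbit \<mu> x \<inter> orbit \<mu> z = {}" using orbit_disjoint x KV[OF z] by blast
    then have "Re x < Re w" "Re w < Re y"
      using axis_orbits_noncrossing[OF pm xy w] z by simp_all
    moreover have "w \<in> A" using w by blast
    ultimately show ?thesis using w z by auto
  qed
  have U: "\<Union>?C = ?K"
  proof
    show "\<Union>?C \<subseteq> ?K" using sub by blast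
    show "?K \<subseteq> \<Union>?C" using orbit_refl by blast
  qed
  have "2 dvd card (\<Union>?C)"
  proof (rule dvd_partition)
    show "finite (\<Union>?C)" unfolding U using finite_A by simp
    show "\<forall>c\<in>?C. 2 dvd card c" using card_axis_orbit[OF pm] by simp
    show "\<forall>c1\<in>?C. \<forall>c2\<in>?C. c1 \<noteq> c2 \<longrightarrow> c1 \<inter> c2 = {}"
    proof (intro ballI impI)
      fix c1 c2 assume "c1 \<in> ?C" "c2 \<in> ?C" "c1 \<noteq> c2"
      then obtain a b where ab: "a \<in> ?K" "b \<in> ?K" "c1 = orbit \<mu> a \<inter> A" "c2 = orbit \<mu> b \<inter> A"
        "orbit \<mu> a \<noteq> orbit \<mu> b" by blast
      then show "c1 \<inter> c2 = {}" using orbit_disjoint[OF KV KV ab(5)] by blast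
    qed
  qed
  then show ?thesis unfolding U .
qed

lemma axis_index_orbit:
  assumes pm: "perfect_matching G \<mu>" and xy: "orbit \<mu> x \<inter> A = {x, y}" "x \<noteq> y"
  shows "even (axis_index x) \<noteq> even (axis_index y)"
proof -
  have *: "even (axis_index u) \<noteq> even (axis_index v)"
    if uv: "orbit \<mu> u \<inter> A = {u, v}" "Re u < Re v" for u v
  proof -
    let ?L = "{z \<in> A. Re z < Re u}" and ?K = "{z \<in> A. Re u < Re z \<and> Re z < Re v}"
    have u: "u \<in> A" using uv(1) by blast
    have "{z \<in> A. Re z < Re v} = insert u (?L \<union> ?K)"
    proof (intro equalityI subsetI)
      fix z assume z: "z \<in> {z \<in> A. Re z < Re v}"
      show "z \<in> insert u (?L \<union> ?K)"
      proof (cases "Re z = Re u")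
        case True
        then show ?thesis using A_eqI[of z u] z u by simp
      next
        case False
        then show ?thesis using z by auto
      qed
    next
      fix z assume "z \<in> insert u (?L \<union> ?K)"
      then show "z \<in> {z \<in> A. Re z < Re v}" using u uv(2) by auto
    qed
    moreover have "card (insert u (?L \<union> ?K)) = Suc (card (?L \<union> ?K))"
      using finite_A by (intro card_insert_disjoint) auto
    moreover have "card (?L \<union> ?K) = card ?L + card ?K"
      using finite_A by (intro card_Un_disjoint) auto
    ultimately have "axis_index v = Suc (axis_index u + card ?K)" by (simp add: axis_index_def)
    then show ?thesis using even_card_between[OF pm uv(1)] by simp
  qed
  have A: "x \<in> A" "y \<in> A" "y \<in> orbit \<mu> x" using xy by blast+
  then have "orbit \<mu> y \<inter> A = {y, x}" using orbit_eq[OF _ A(3)] xy(1) by (auto simp: A_iff)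
  then show ?thesis
    using *[of x y] *[of y x] xy A_eqI[OF A(1,2)] by (cases "Re x" "Re y" rule: linorder_cases) auto
qed


section \<open>Reflecting a matching on a union of orbits\<close>

text \<open>For closed \<open>U\<close> a matching edge has both ends in \<open>U\<close> or
  neither, so the test treats the two ends alike.\<close>

definition flip_edge :: "complex set \<Rightarrow> complex set \<Rightarrow> complex set" where
  "flip_edge U e = (if e \<inter> U = {} then e else \<sigma> ` e)"

definition flip :: "complex set \<Rightarrow> complex set set \<Rightarrow> complex set set" where
  "flip U \<mu> = flip_edge U ` \<mu>"

context
  fixes \<mu> U assumes pm: "perfect_matching G \<mu>" and U: "closed_under \<mu> U"
begin

lemma reflect_meets_iff: "\<sigma> ` e \<inter> U = {} \<longleftrightarrow> e \<inter> U = {}"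
proof -
  have "\<sigma> ` e \<inter> U = \<sigma> ` (e \<inter> U)"
    using closed_under_reflect[OF U] by (auto simp: mem_reflect_image_iff)
  then show ?thesis by simp
qed

lemma flip_edge_flip_edge: "flip_edge U (flip_edge U e) = e"
  by (simp add: flip_edge_def reflect_meets_iff)

lemma flip_flip: "flip U (flip U \<mu>) = \<mu>"
  by (simp add: flip_def image_image flip_edge_flip_edge)

lemma prod_weight_flip: "(\<Prod>e\<in>flip U \<mu>. weight G e) = (\<Prod>e\<in>\<mu>. weight G e)"
proof -
  have "inj_on (flip_edge U) \<mu>" by (metis flip_edge_flip_edge inj_onI)
  then have "(\<Prod>e\<in>flip U \<mu>. weight G e) = (\<Prod>e\<in>\<mu>. weight G (flip_edge U e))"
    by (simp add: flip_def prod.reindex)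
  also have "\<dots> = (\<Prod>e\<in>\<mu>. weight G e)"
    using matching_subset[OF pm] weight_reflect by (intro prod.cong) (auto simp: flip_edge_def)
  finally show ?thesis .
qed

text \<open>Inside \<open>U\<close> the edge that covers \<open>v\<close> after flipping is the
  mirror image of the one that covered the mirror image of \<open>v\<close>. Existence and
  uniqueness of the new matching edge both follow.\<close>

lemma flip_edge_at:
  assumes v: "v \<in> V" and e: "e \<in> \<mu>"
  shows "v \<in> flip_edge U e \<longleftrightarrow> e = medge \<mu> (if v \<in> U then \<sigma> v else v)"
proof (cases "e \<inter> U = {}")
  case True
  then have fe: "flip_edge U e = e" by (simp add: flip_edge_def)
  show ?thesis
  proof (cases "v \<in> U")
    case True
    then have "\<sigma> v \<in> U" using closed_under_reflect[OF U] by simp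
    moreover have "\<sigma> v \<in> medge \<mu> (\<sigma> v)" using medge(2)[OF pm] v by simp
    ultimately show ?thesis using \<open>v \<in> U\<close> \<open>e \<inter> U = {}\<close> fe by auto
  next
    case False
    then show ?thesis using fe medge[OF pm v] medge_unique[OF pm v e] by auto
  qed
next
  case False
  then have fe: "flip_edge U e = \<sigma> ` e" by (simp add: flip_edge_def)
  obtain u where u: "u \<in> e" "u \<in> U" using False by blast
  have eU: "w \<in> U" if "w \<in> e" "w \<in> V" for w using closed_under_edge[OF U e u that] .
  have \<sigma>v: "\<sigma> v \<in> V" using v by simp
  show ?thesis
  proof (cases "v \<in> U")
    case True
    then show ?thesis
      using fe medge[OF pm \<sigma>v] medge_unique[OF pm \<sigma>v e] by (auto simp: mem_reflect_image_iff)
  next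
    case False
    then have "\<sigma> v \<notin> U" using closed_under_reflect[OF U] by simp
    then have "\<sigma> v \<notin> e" "v \<notin> e" using eU v \<sigma>v False by blast+
    then show ?thesis using fe medge(2)[OF pm v] False by (auto simp: mem_reflect_image_iff)
  qed
qed

lemma perfect_matching_flip: "perfect_matching G (flip U \<mu>)"
  unfolding perfect_matching_def
proof (intro conjI ballI)
  show "flip U \<mu> \<subseteq> E" using matching_subset[OF pm] by (auto simp: flip_def flip_edge_def)
  fix v assume v: "v \<in> V"
  let ?w = "if v \<in> U then \<sigma> v else v"
  have "?w \<in> V" using v by simp
  then have m: "medge \<mu> ?w \<in> \<mu>" by (rule medge(1)[OF pm])
  show "\<exists>!e. e \<in> flip U \<mu> \<and> v \<in> e"
  proof (rule ex1I)
    show "flip_edge U (medge \<mu> ?w) \<in> flip U \<mu> \<and> v \<in> flip_edge U (medge \<mu> ?w)"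
      using m flip_edge_at[OF v m] by (simp add: flip_def)
    show "e = flip_edge U (medge \<mu> ?w)" if "e \<in> flip U \<mu> \<and> v \<in> e" for e
      using that flip_edge_at[OF v] by (auto simp: flip_def)
  qed
qed

lemma medge_flip:
  assumes x: "x \<in> A"
  shows "medge (flip U \<mu>) x = (if x \<in> U then \<sigma> ` medge \<mu> x else medge \<mu> x)"
proof -
  have xV: "x \<in> V" "\<sigma> x = x" using x by (simp_all add: A_iff)
  have m: "medge \<mu> x \<in> \<mu>" "x \<in> medge \<mu> x" using medge[OF pm xV(1)] .
  have "x \<in> flip_edge U (medge \<mu> x)" using flip_edge_at[OF xV(1) m(1)] xV(2) by simp
  then have "medge (flip U \<mu>) x = flip_edge U (medge \<mu> x)"
    using medge_unique[OF perfect_matching_flip xV(1)] m(1) by (simp add: flip_def)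
  moreover have "medge \<mu> x \<inter> U = {} \<longleftrightarrow> x \<notin> U"
    using m(2) closed_under_edge[OF U m(1) _ _ m(2) xV(1)] by blast
  ultimately show ?thesis by (simp add: flip_edge_def)
qed

lemma closed_under_flip:
  assumes X: "closed_under \<mu> X" shows "closed_under (flip U \<mu>) X"
proof (rule closed_underI)
  show "X \<subseteq> V" using closed_under_subset[OF X] .
  show "\<sigma> v \<in> X" if "v \<in> X" for v using that closed_under_reflect[OF X] by simp
  fix e v w assume e: "e \<in> flip U \<mu>" "v \<in> e" "v \<in> X" "w \<in> e" "w \<in> V"
  then obtain e' where e': "e' \<in> \<mu>" "e = e' \<or> e = \<sigma> ` e'"
    by (auto simp: flip_def flip_edge_def split: if_splits)
  from e'(2) show "w \<in> X"
  proof
    assume "e = e'"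
    then show ?thesis using closed_under_edge[OF X e'(1), of v w] e by simp
  next
    assume "e = \<sigma> ` e'"
    then have "\<sigma> v \<in> e'" "\<sigma> w \<in> e'" using e by (simp_all add: mem_reflect_image_iff)
    then have "\<sigma> w \<in> X"
      using closed_under_edge[OF X e'(1), of "\<sigma> v" "\<sigma> w"] closed_under_reflect[OF X] e by simp
    then show ?thesis using closed_under_reflect[OF X] by simp
  qed
qed

end

text \<open>Flipping twice restores the matching, so both matchings have the same closed sets.
  Orbits thus serve as a common reference for a matching and all its partial reflections.\<close>

lemma orbit_flip:
  assumes pm: "perfect_matching G \<mu>" and U: "closed_under \<mu> U"
  shows "orbit (flip U \<mu>) x = orbit \<mu> x"
proof -
  have "closed_under (flip U \<mu>) X \<longleftrightarrow> closed_under \<mu> X" for X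
    using closed_under_flip[OF pm U] closed_under_flip[OF perfect_matching_flip[OF pm U]
        closed_under_flip[OF pm U U]] flip_flip[OF pm U] by metis
  then show ?thesis by (simp add: orbit_def)
qed

end

locale coloured_symmetric_plane_graph = symmetric_plane_graph +
  fixes W B :: "complex set"
  assumes bipartition_WB: "bipartition (upper_subgraph h G) W B"
begin

lemma upper_edge_colours:
  assumes e: "e \<in> E" "e \<subseteq> {z. h \<le> Im z}" and uv: "e \<inter> V = {u, v}" "u \<noteq> v"
  shows "u \<in> W \<longleftrightarrow> v \<notin> W"
proof -
  have WB: "W \<union> B = V \<inter> {z. h \<le> Im z}" "W \<inter> B = {}" "e \<inter> W \<noteq> {}" "e \<inter> B \<noteq> {}"
    using bipartition_WB e by (auto simp: bipartition_def upper_subgraph_def induced_subgraph_def)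
  have "W \<subseteq> V" "B \<subseteq> V" using WB(1) by blast+
  then have "e \<inter> W = {u, v} \<inter> W" "e \<inter> B = {u, v} \<inter> B" unfolding uv(1)[symmetric] by blast+
  then have "u \<in> W \<or> v \<in> W" "u \<in> B \<or> v \<in> B" using WB(3,4) by auto
  then show ?thesis using WB(2) by auto
qed

text \<open>Colours exist only on or above the axis; a lower vertex borrows that of its mirror
  image. Crossing edges are excluded because their ends fold to one vertex.\<close>

lemma noncrossing_edge_colours:
  assumes e: "e \<in> E" and uv: "e \<inter> V = {u, v}" "u \<noteq> v" "v \<noteq> \<sigma> u"
  shows "fold_up h u \<in> W \<longleftrightarrow> fold_up h v \<notin> W"
proof -
  have u: "u \<in> e" "u \<in> V" "v \<in> e" using uv(1) by blast+
  have ends: "e \<inter> V \<noteq> {u, \<sigma> u}" using uv by (metis doubleton_eq_iff)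
  from e u(1,2) ends show ?thesis
  proof (cases rule: edge_cases_noncrossing)
    case axis
    then have "e \<subseteq> {z. h \<le> Im z}" "u \<in> axis h" "v \<in> axis h" using u by (auto simp: axis_def)
    then show ?thesis using upper_edge_colours[OF e _ uv(1,2)] by (simp add: fold_up_axis)
  next
    case above
    then have up: "e \<subseteq> {z. h \<le> Im z}" using above_imp_upper[OF e] by simp
    then have "fold_up h u = u" "fold_up h v = v" using u by (auto simp: fold_up_def)
    then show ?thesis using upper_edge_colours[OF e up uv(1,2)] by simp
  next
    case below
    then have low: "e \<subseteq> {z. Im z \<le> h}" using below_imp_lower[OF e] by simp
    have fold: "fold_up h w = \<sigma> w" if "w \<in> e" for w
    proof -
      have "Im w \<le> h" using that low by blast
      then show ?thesis by (simp add: fold_up_altdef complex_eq_iff)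
    qed
    have "\<sigma> ` e \<in> E" "\<sigma> ` e \<subseteq> {z. h \<le> Im z}" "\<sigma> ` e \<inter> V = {\<sigma> u, \<sigma> v}" "\<sigma> u \<noteq> \<sigma> v"
      using e low uv by (auto simp: reflect_edge_Int_V reflect_eq_iff)
    then have "\<sigma> u \<in> W \<longleftrightarrow> \<sigma> v \<notin> W" by (rule upper_edge_colours)
    then show ?thesis using fold u by simp
  qed
qed

text \<open>Along the folded path from \<open>x\<close> to \<open>y\<close> the vertices alternate in colour, and the matching
  edges alternate in side; a path with \<open>m\<close> edges therefore changes the colour \<open>m\<close> times and the side
  \<open>m - 1\<close> times.\<close>

lemma orbit_ends_sides:
  assumes pm: "perfect_matching G \<mu>" and xy: "orbit \<mu> x \<inter> A = {x, y}" "x \<noteq> y"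
    and nonaxis: "\<not> medge \<mu> x \<subseteq> axis h"
  shows "(above (medge \<mu> y) \<longleftrightarrow> y \<in> W) \<noteq> (above (medge \<mu> x) \<longleftrightarrow> x \<in> W)"
proof -
  have xA: "x \<in> A" and x: "x \<in> V" "\<sigma> x = x" using xy(1) by (auto simp: A_iff)
  define z where "z = (\<lambda>k. ((\<sigma> \<circ> partner \<mu>) ^^ k) x)"
  have z0: "z 0 = x" and zSuc: "z (Suc k) = \<sigma> (partner \<mu> (z k))" for k
    by (simp_all add: z_def)
  obtain m where m: "0 < m" "z m \<noteq> x" "orbit \<mu> x \<inter> A = {x, z m}"
    "\<And>k. 0 < k \<Longrightarrow> k < m \<Longrightarrow> z k \<notin> axis h" "range z = orbit \<mu> x"
    by (rule axis_orbit_path[of \<mu> x z, OF pm xA z0 zSuc], rule that)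
  have zm: "z m = y" using m(2,3) xy by (metis doubleton_eq_iff)
  have zV: "z k \<in> V" for k
    by (induction k) (use x partner[OF pm] in \<open>auto simp: z0 zSuc\<close>)
  note p = partner[OF pm zV]
  have pz: "partner \<mu> (z k) = \<sigma> (z (Suc k))" for k by (simp add: zSuc)
  \<comment> \<open>No edge of the path crosses the axis: a crossing edge at
    \<open>z (Suc k)\<close> would also be the edge at \<open>z k\<close>, and so on back to
    \<open>x\<close>, which would be its own partner.\<close>
  have z_ne: "z (Suc k) \<noteq> z k" for k
  proof (induction k)
    case 0
    show ?case using p(2)[of 0] x by (simp add: z0 zSuc reflect_eq_iff)
  next
    case (Suc k)
    then show ?case
      by (metis partner_partner[OF pm zV] pz reflect_reflect)
  qed
  define e where "e k = medge \<mu> (z k)" for k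
  have eE: "e k \<in> E" "z k \<in> e k" "e k \<inter> V = {z k, \<sigma> (z (Suc k))}" "\<sigma> (z (Suc k)) \<noteq> z k" for k
    using medge_in_E[OF pm zV] medge(2)[OF pm zV] p(1,2)[of k] by (simp_all add: e_def pz)
  have ends: "e k \<inter> V \<noteq> {z k, \<sigma> (z k)}" and ends': "e k \<inter> V \<noteq> {\<sigma> (z (Suc k)), \<sigma> (\<sigma> (z (Suc k)))}" for k
    using eE(3,4)[of k] z_ne[of k] by (metis doubleton_eq_iff reflect_reflect)+
  have colour: "fold_up h (z k) \<in> W \<longleftrightarrow> (x \<in> W \<longleftrightarrow> even k)" for k
  proof (induction k)
    case 0
    show ?case using xA by (simp add: z0 fold_up_axis axis_verts_def)
  next
    case (Suc k)
    have "\<sigma> (z (Suc k)) \<noteq> \<sigma> (z k)" using z_ne[of k] by (metis reflect_reflect)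
    then have "fold_up h (z k) \<in> W \<longleftrightarrow> fold_up h (\<sigma> (z (Suc k))) \<notin> W"
      using noncrossing_edge_colours[OF eE(1,3)] eE(4)[of k] by metis
    with Suc show ?case by auto
  qed
  \<comment> \<open>The edge \<open>e k\<close> ends at the mirror image of the vertex where
    \<open>e (Suc k)\<close> starts. For an inner vertex, which is off the axis, the two edges
    therefore lie on opposite sides.\<close>
  have side: "(above (e k) \<longleftrightarrow> (above (e 0) \<longleftrightarrow> even k)) \<and> (above (e k) \<or> below (e k))" if "k < m" for k
    using that
  proof (induction k)
    case 0
    have "e 0 \<in> E" "x \<in> e 0" using eE(1,2)[of 0] by (simp_all add: z0)
    then have "above (e 0) \<or> below (e 0)"
      using edge_at_axis_vertex_cases[OF _ _ xA, of "e 0"] nonaxis by (auto simp: e_def z0)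
    then show ?case by simp
  next
    case (Suc k)
    let ?v = "z (Suc k)"
    have v': "\<sigma> ?v \<in> e k" using eE(3)[of k] by blast
    have "Im ?v \<noteq> h" using m(4)[of "Suc k"] Suc.prems by (simp add: axis_def)
    then consider "h < Im ?v" | "Im ?v < h" by linarith
    then show ?case
    proof cases
      case 1
      have "above (e (Suc k))"
        using noncrossing_edge_above[OF eE(1,2) zV 1 ends] .
      moreover have "below (e k)"
        using noncrossing_edge_below[OF eE(1) v' _ _ ends'] zV 1 by simp
      then have "\<not> above (e k)" using side_exclusive(1)[OF eE(1)] by blast
      ultimately show ?thesis using Suc by auto
    next
      case 2
      have "below (e (Suc k))"
        using noncrossing_edge_below[OF eE(1,2) zV 2 ends] .
      then have "\<not> above (e (Suc k))" using side_exclusive(1)[OF eE(1)] by blast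
      moreover have "above (e k)"
        using noncrossing_edge_above[OF eE(1) v' _ _ ends'] zV 2 by simp
      ultimately show ?thesis using Suc \<open>below (e (Suc k))\<close> by auto
    qed
  qed
  obtain l where l: "m = Suc l" using m(1) by (cases m) auto
  have y: "y \<in> A" using xy(1) by blast
  then have yV: "y \<in> V" "\<sigma> y = y" by (simp_all add: A_iff)
  \<comment> \<open>As \<open>y\<close> is its own mirror image, the edge with index
    \<open>l = m - 1\<close> ends at \<open>y\<close> itself.\<close>
  have "y \<in> e l" using eE(3)[of l] zm l yV by auto
  then have "medge \<mu> y = e l"
    using medge_unique[OF pm yV(1)] medge(1)[OF pm zV] by (simp add: e_def)
  moreover have "medge \<mu> x = e 0" by (simp add: e_def z0)
  moreover have "y \<in> W \<longleftrightarrow> (x \<in> W \<longleftrightarrow> even m)"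
    using colour[of m] zm y by (simp add: fold_up_axis axis_verts_def)
  moreover have "above (e l) \<longleftrightarrow> (above (e 0) \<longleftrightarrow> even l)" using side[of l] l by simp
  ultimately show ?thesis using l by auto
qed


section \<open>Bad axis vertices\<close>

text \<open>Even positions are those of \<open>a\<close>-vertices, so these are the white
  \<open>a\<close>-vertices and the black \<open>b\<close>-vertices; \<open>low_cut\<close> holds
  the remaining axis vertices.\<close>

definition up_cut :: "complex set" where
  "up_cut = {x \<in> A. even (axis_index x) \<longleftrightarrow> x \<in> W}"

definition low_cut :: "complex set" where
  "low_cut = {x \<in> A. even (axis_index x) \<longleftrightarrow> x \<notin> W}"

text \<open>A vertex is bad if its matching edge is one of those removed by cutting.\<close>

definition bad :: "complex set set \<Rightarrow> complex \<Rightarrow> bool" where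
  "bad \<mu> x \<longleftrightarrow> above (medge \<mu> x) \<and> x \<in> up_cut \<or> below (medge \<mu> x) \<and> x \<in> low_cut"

text \<open>These orbits do contain axis vertices, but are not matched along the axis there. They
  are the ones whose reflection changes the matching at the axis.\<close>

definition nonaxis_orbits :: "complex set set \<Rightarrow> complex set set" where
  "nonaxis_orbits \<mu> = orbit \<mu> ` {x \<in> A. \<not> medge \<mu> x \<subseteq> axis h}"

definition bad_orbits :: "complex set set \<Rightarrow> complex set set" where
  "bad_orbits \<mu> = orbit \<mu> ` {x \<in> A. bad \<mu> x}"

lemma axis_medge_cases:
  assumes pm: "perfect_matching G \<mu>" and x: "x \<in> A"
  obtains (axis) "medge \<mu> x \<subseteq> axis h" "\<not> above (medge \<mu> x)" "\<not> below (medge \<mu> x)"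
    | (above) "\<not> medge \<mu> x \<subseteq> axis h" "above (medge \<mu> x)" "\<not> below (medge \<mu> x)"
    | (below) "\<not> medge \<mu> x \<subseteq> axis h" "\<not> above (medge \<mu> x)" "below (medge \<mu> x)"
proof -
  have xV: "x \<in> V" using x by (simp add: A_iff)
  note e = medge_in_E[OF pm xV] medge(2)[OF pm xV]
  from e x show thesis
    by (cases rule: edge_at_axis_vertex_cases) (use side_exclusive[OF e(1)] that in blast)+
qed

lemma bad_imp_nonaxis: "perfect_matching G \<mu> \<Longrightarrow> x \<in> A \<Longrightarrow> bad \<mu> x \<Longrightarrow> \<not> medge \<mu> x \<subseteq> axis h"
  by (erule (1) axis_medge_cases) (auto simp: bad_def)

text \<open>Off the axis, not above means below, so badness becomes a comparison of position, side
  and colour whose changes along an orbit can be counted.\<close>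

lemma bad_nonaxis_iff:
  assumes "perfect_matching G \<mu>" "x \<in> A" "\<not> medge \<mu> x \<subseteq> axis h"
  shows "bad \<mu> x \<longleftrightarrow> (even (axis_index x) \<longleftrightarrow> (above (medge \<mu> x) \<longleftrightarrow> x \<in> W))"
  using assms(1,2) by (cases rule: axis_medge_cases)
    (use assms in \<open>auto simp: bad_def up_cut_def low_cut_def\<close>)

text \<open>Between the two axis vertices of an orbit the parity of the position changes, and so
  does the agreement of side and colour; the two changes cancel in the criterion for
  badness.\<close>

lemma axis_orbit_constant:
  assumes pm: "perfect_matching G \<mu>" and xy: "x \<in> A" "y \<in> A" "orbit \<mu> y = orbit \<mu> x"
  shows "medge \<mu> y \<subseteq> axis h \<longleftrightarrow> medge \<mu> x \<subseteq> axis h" "bad \<mu> y \<longleftrightarrow> bad \<mu> x"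
proof -
  have axis: "medge \<mu> v \<subseteq> axis h"
    if uv: "u \<in> A" "v \<in> A" "orbit \<mu> v = orbit \<mu> u" "medge \<mu> u \<subseteq> axis h" for u v
  proof -
    have V: "u \<in> V" "v \<in> V" using uv by (simp_all add: A_iff)
    have "v \<in> orbit \<mu> u \<inter> A" using orbit_refl[of v \<mu>] uv(2,3) by simp
    then have "v \<in> medge \<mu> u" using axis_matching_edge_orbit[OF pm uv(1,4)] by simp
    then have "medge \<mu> v = medge \<mu> u" using medge_unique[OF pm V(2)] medge(1)[OF pm V(1)] by simp
    then show ?thesis using uv(4) by simp
  qed
  then show iff: "medge \<mu> y \<subseteq> axis h \<longleftrightarrow> medge \<mu> x \<subseteq> axis h" using xy by metis
  show "bad \<mu> y \<longleftrightarrow> bad \<mu> x"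
  proof (cases "x = y \<or> medge \<mu> x \<subseteq> axis h")
    case True
    then show ?thesis using bad_imp_nonaxis[OF pm] xy iff by blast
  next
    case False
    obtain w where w: "orbit \<mu> x \<inter> A = {x, w}" using axis_orbit[OF pm xy(1)] by metis
    have "y \<in> orbit \<mu> x \<inter> A" using orbit_refl[of y \<mu>] xy by simp
    then have eq: "orbit \<mu> x \<inter> A = {x, y}" using w False by auto
    show ?thesis
      using bad_nonaxis_iff[OF pm xy(1)] bad_nonaxis_iff[OF pm xy(2)] False iff
        orbit_ends_sides[OF pm eq] axis_index_orbit[OF pm eq] by blast
  qed
qed

text \<open>Distinct orbits are disjoint, so a set of orbits can be recovered from its
  union.\<close>

lemma Union_axis_orbits:
  assumes pm: "perfect_matching G \<mu>" and x: "x \<in> A" and T: "T \<subseteq> orbit \<mu> ` A"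
  shows "x \<in> \<Union>T \<longleftrightarrow> orbit \<mu> x \<in> T"
proof
  assume "x \<in> \<Union>T"
  then obtain y where y: "y \<in> A" "orbit \<mu> y \<in> T" "x \<in> orbit \<mu> y" using T by blast
  then show "orbit \<mu> x \<in> T" using orbit_eq[OF _ y(3)] by (simp add: A_iff)
qed (use orbit_refl in blast)

lemma closed_under_Union_axis_orbits:
  assumes "T \<subseteq> orbit \<mu> ` A" shows "closed_under \<mu> (\<Union>T)"
  using assms closed_under_orbit by (intro closed_under_Union) (auto simp: A_iff)

lemma nonaxis_orbits_subset: "nonaxis_orbits \<mu> \<subseteq> orbit \<mu> ` A"
  by (auto simp: nonaxis_orbits_def)

lemma orbit_in_nonaxis_orbits_iff:
  assumes pm: "perfect_matching G \<mu>" and x: "x \<in> A"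
  shows "orbit \<mu> x \<in> nonaxis_orbits \<mu> \<longleftrightarrow> \<not> medge \<mu> x \<subseteq> axis h"
proof
  assume "orbit \<mu> x \<in> nonaxis_orbits \<mu>"
  then obtain y where "y \<in> A" "orbit \<mu> x = orbit \<mu> y" "\<not> medge \<mu> y \<subseteq> axis h"
    by (auto simp: nonaxis_orbits_def)
  then show "\<not> medge \<mu> x \<subseteq> axis h" using axis_orbit_constant(1)[OF pm] x by metis
qed (use x in \<open>auto simp: nonaxis_orbits_def\<close>)

lemma orbit_in_bad_orbits_iff:
  assumes pm: "perfect_matching G \<mu>" and x: "x \<in> A"
  shows "orbit \<mu> x \<in> bad_orbits \<mu> \<longleftrightarrow> bad \<mu> x"
proof
  assume "orbit \<mu> x \<in> bad_orbits \<mu>"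
  then obtain y where "y \<in> A" "orbit \<mu> x = orbit \<mu> y" "bad \<mu> y" by (auto simp: bad_orbits_def)
  then show "bad \<mu> x" using axis_orbit_constant(2)[OF pm] x by metis
qed (use x in \<open>auto simp: bad_orbits_def\<close>)

lemma bad_orbits_subset:
  "perfect_matching G \<mu> \<Longrightarrow> bad_orbits \<mu> \<subseteq> nonaxis_orbits \<mu>"
  using bad_imp_nonaxis by (auto simp: bad_orbits_def nonaxis_orbits_def)

text \<open>Reflection exchanges above and below and fixes position and colour, so it toggles
  badness exactly on the orbits in \<open>T\<close>. The supply of reflectable orbits stays the
  same, which makes the choice of \<open>T\<close> reversible.\<close>

lemma flip_axis_orbits:
  assumes pm: "perfect_matching G \<mu>" and T: "T \<subseteq> nonaxis_orbits \<mu>"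
  shows "perfect_matching G (flip (\<Union>T) \<mu>)" "flip (\<Union>T) (flip (\<Union>T) \<mu>) = \<mu>"
    "nonaxis_orbits (flip (\<Union>T) \<mu>) = nonaxis_orbits \<mu>"
    "x \<in> A \<Longrightarrow> bad (flip (\<Union>T) \<mu>) x \<longleftrightarrow> (bad \<mu> x \<longleftrightarrow> orbit \<mu> x \<notin> T)"
    "(\<Prod>e\<in>flip (\<Union>T) \<mu>. weight G e) = (\<Prod>e\<in>\<mu>. weight G e)"
proof -
  have TA: "T \<subseteq> orbit \<mu> ` A" using T nonaxis_orbits_subset by blast
  note U = closed_under_Union_axis_orbits[OF TA]
  show pm': "perfect_matching G (flip (\<Union>T) \<mu>)" by (rule perfect_matching_flip[OF pm U])
  show "flip (\<Union>T) (flip (\<Union>T) \<mu>) = \<mu>" by (rule flip_flip[OF pm U])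
  show "(\<Prod>e\<in>flip (\<Union>T) \<mu>. weight G e) = (\<Prod>e\<in>\<mu>. weight G e)"
    by (rule prod_weight_flip[OF pm U])
  have axis: "medge (flip (\<Union>T) \<mu>) x \<subseteq> axis h \<longleftrightarrow> medge \<mu> x \<subseteq> axis h" if "x \<in> A" for x
    using medge_flip[OF pm U that] by simp
  then show "nonaxis_orbits (flip (\<Union>T) \<mu>) = nonaxis_orbits \<mu>"
    unfolding nonaxis_orbits_def orbit_flip[OF pm U] by auto
  show "bad (flip (\<Union>T) \<mu>) x \<longleftrightarrow> (bad \<mu> x \<longleftrightarrow> orbit \<mu> x \<notin> T)" if x: "x \<in> A" for x
  proof (cases "orbit \<mu> x \<in> T")
    case True
    then have na: "\<not> medge \<mu> x \<subseteq> axis h" using T orbit_in_nonaxis_orbits_iff[OF pm x] by blast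
    have "medge (flip (\<Union>T) \<mu>) x = \<sigma> ` medge \<mu> x"
      using medge_flip[OF pm U x] Union_axis_orbits[OF pm x TA] True by simp
    then have "above (medge (flip (\<Union>T) \<mu>) x) \<longleftrightarrow> \<not> above (medge \<mu> x)"
      using na by (cases rule: axis_medge_cases[OF pm x]) simp_all
    then show ?thesis
      using bad_nonaxis_iff[OF pm x na] bad_nonaxis_iff[OF pm' x] axis[OF x] na True by blast
  next
    case False
    then have "medge (flip (\<Union>T) \<mu>) x = medge \<mu> x"
      using medge_flip[OF pm U x] Union_axis_orbits[OF pm x TA] by simp
    then show ?thesis using False by (simp add: bad_def)
  qed
qed


section \<open>Counting\<close>

definition good_matchings :: "complex set set set" where
  "good_matchings = {\<mu>. perfect_matching G \<mu> \<and> (\<forall>x\<in>A. \<not> bad \<mu> x)}"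

lemma finite_perfect_matchings: "finite {\<mu>. perfect_matching G \<mu>}"
  by (rule finite_subset[of _ "Pow E"]) (use finite_E in \<open>auto simp: perfect_matching_def\<close>)

lemma finite_nonaxis_orbits: "finite (nonaxis_orbits \<mu>)"
  using finite_A by (simp add: nonaxis_orbits_def)

text \<open>A perfect matching is determined by the good matching that results from reflecting all its
  bad orbits, together with the set of these orbits.\<close>

lemma matching_sum_good:
  "matching_sum G = (\<Sum>\<nu>\<in>good_matchings. 2 ^ card (nonaxis_orbits \<nu>) * (\<Prod>e\<in>\<nu>. weight G e))"
proof -
  let ?w = "\<lambda>\<mu>. \<Prod>e\<in>\<mu>. weight G e"
  let ?S = "SIGMA \<nu>:good_matchings. Pow (nonaxis_orbits \<nu>)"
  have "matching_sum G = (\<Sum>(\<nu>, T)\<in>?S. ?w \<nu>)"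
    unfolding matching_sum_def
  proof (rule sum.reindex_bij_witness[of _ "\<lambda>(\<nu>, T). flip (\<Union>T) \<nu>"
        "\<lambda>\<mu>. (flip (\<Union>(bad_orbits \<mu>)) \<mu>, bad_orbits \<mu>)"])
    fix \<mu> assume "\<mu> \<in> {\<mu>. perfect_matching G \<mu>}"
    then have pm: "perfect_matching G \<mu>" by simp
    note f = flip_axis_orbits[OF pm bad_orbits_subset[OF pm]]
    show "(case (flip (\<Union>(bad_orbits \<mu>)) \<mu>, bad_orbits \<mu>) of (\<nu>, T) \<Rightarrow> flip (\<Union>T) \<nu>) = \<mu>"
      using f(2) by simp
    show "(flip (\<Union>(bad_orbits \<mu>)) \<mu>, bad_orbits \<mu>) \<in> ?S"
      using f(1,3,4) orbit_in_bad_orbits_iff[OF pm] bad_orbits_subset[OF pm]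
      by (simp add: good_matchings_def)
    show "(case (flip (\<Union>(bad_orbits \<mu>)) \<mu>, bad_orbits \<mu>) of (\<nu>, T) \<Rightarrow> ?w \<nu>) = ?w \<mu>"
      using f(5) by simp
  next
    fix p assume "p \<in> ?S"
    then obtain \<nu> T where p: "p = (\<nu>, T)" and pm: "perfect_matching G \<nu>"
      and good: "\<And>x. x \<in> A \<Longrightarrow> \<not> bad \<nu> x" and T: "T \<subseteq> nonaxis_orbits \<nu>"
      by (auto simp: good_matchings_def)
    note f = flip_axis_orbits[OF pm T]
    have TA: "T \<subseteq> orbit \<nu> ` A" using T nonaxis_orbits_subset by blast
    \<comment> \<open>Starting from no bad vertex, toggling on \<open>T\<close> makes precisely the
      orbits in \<open>T\<close> bad.\<close>
    have "bad_orbits (flip (\<Union>T) \<nu>) = orbit \<nu> ` {x \<in> A. orbit \<nu> x \<in> T}"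
      unfolding bad_orbits_def orbit_flip[OF pm closed_under_Union_axis_orbits[OF TA]]
      using f(4) good by auto
    also have "\<dots> = T" using TA by blast
    finally have b: "bad_orbits (flip (\<Union>T) \<nu>) = T" .
    show "(case p of (\<nu>, T) \<Rightarrow> flip (\<Union>T) \<nu>) \<in> {\<mu>. perfect_matching G \<mu>}"
      using f(1) p by simp
    show "(flip (\<Union>(bad_orbits (case p of (\<nu>, T) \<Rightarrow> flip (\<Union>T) \<nu>))) (case p of (\<nu>, T) \<Rightarrow> flip (\<Union>T) \<nu>),
        bad_orbits (case p of (\<nu>, T) \<Rightarrow> flip (\<Union>T) \<nu>)) = p"
      using b f(2) p by simp
  qed
  also have "\<dots> = (\<Sum>\<nu>\<in>good_matchings. \<Sum>T\<in>Pow (nonaxis_orbits \<nu>). ?w \<nu>)"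
    using finite_perfect_matchings finite_nonaxis_orbits
    by (intro sum.Sigma[symmetric]) (auto simp: good_matchings_def)
  also have "\<dots> = (\<Sum>\<nu>\<in>good_matchings. 2 ^ card (nonaxis_orbits \<nu>) * ?w \<nu>)"
    by (simp add: card_Pow finite_nonaxis_orbits)
  finally show ?thesis .
qed

text \<open>Orbits partition the axis vertices into pairs, and each orbit is either a nonaxis orbit
  or comes from exactly one matching edge on the axis.\<close>

lemma card_axis_matching_edges:
  assumes pm: "perfect_matching G \<mu>"
  shows "2 * (card (nonaxis_orbits \<mu>) + card {e \<in> \<mu>. e \<subseteq> axis h}) = card A"
proof -
  let ?P = "orbit \<mu> ` {x \<in> A. medge \<mu> x \<subseteq> axis h}"
  let ?K = "{e \<in> \<mu>. e \<subseteq> axis h}"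
  let ?C = "(\<lambda>Q. Q \<inter> A) ` orbit \<mu> ` A"
  have inj: "inj_on (\<lambda>Q. Q \<inter> A) (orbit \<mu> ` A)"
  proof (rule inj_onI)
    fix O1 O2 assume Q: "O1 \<in> orbit \<mu> ` A" "O2 \<in> orbit \<mu> ` A" "O1 \<inter> A = O2 \<inter> A"
    then obtain x y where xy: "x \<in> A" "y \<in> A" "O1 = orbit \<mu> x" "O2 = orbit \<mu> y" by blast
    then have "x \<in> orbit \<mu> y" using Q(3) orbit_refl[of x \<mu>] by blast
    then show "O1 = O2" using orbit_eq[of y x \<mu>] xy by (simp add: A_iff)
  qed
  have UC: "\<Union>?C = A" using orbit_refl by blast
  have "2 * card ?C = card (\<Union>?C)"
  proof (rule card_partition)
    show "finite ?C" using finite_A by simp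
    show "finite (\<Union>?C)" unfolding UC using finite_A .
    show "card c = 2" if "c \<in> ?C" for c using that card_axis_orbit[OF pm] by auto
    show "c1 \<inter> c2 = {}" if c: "c1 \<in> ?C" "c2 \<in> ?C" "c1 \<noteq> c2" for c1 c2
    proof -
      obtain a b where ab: "a \<in> A" "b \<in> A" "c1 = orbit \<mu> a \<inter> A" "c2 = orbit \<mu> b \<inter> A"
        using c by blast
      then have "orbit \<mu> a \<noteq> orbit \<mu> b" using c(3) by auto
      moreover have "a \<in> V" "b \<in> V" using ab by (simp_all add: A_iff)
      ultimately have "orbit \<mu> a \<inter> orbit \<mu> b = {}" by (intro orbit_disjoint)
      then show ?thesis using ab by blast
    qed
  qed
  then have card_A: "2 * card (orbit \<mu> ` A) = card A"
    unfolding UC using card_image[OF inj] by simp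
  have "orbit \<mu> ` A = nonaxis_orbits \<mu> \<union> ?P" by (auto simp: nonaxis_orbits_def)
  moreover have "nonaxis_orbits \<mu> \<inter> ?P = {}" using orbit_in_nonaxis_orbits_iff[OF pm] by auto
  ultimately have "card (orbit \<mu> ` A) = card (nonaxis_orbits \<mu>) + card ?P"
    using finite_A finite_nonaxis_orbits by (simp add: card_Un_disjoint)
  moreover have "card ?P = card ?K"
  proof -
    \<comment> \<open>Orbits and edges are compared through the pair of axis vertices that they
      contain; both maps to such pairs are injective here.\<close>
    have "(\<lambda>Q. Q \<inter> A) ` ?P = (\<lambda>e. e \<inter> V) ` ?K"
    proof (intro equalityI subsetI)
      fix c assume "c \<in> (\<lambda>Q. Q \<inter> A) ` ?P"
      then obtain x where x: "x \<in> A" "medge \<mu> x \<subseteq> axis h" "c = orbit \<mu> x \<inter> A" by blast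
      then have "c = medge \<mu> x \<inter> V" using axis_matching_edge_orbit[OF pm] by simp
      moreover have "medge \<mu> x \<in> \<mu>" using medge(1)[OF pm] x(1) by (simp add: A_iff)
      ultimately show "c \<in> (\<lambda>e. e \<inter> V) ` ?K" using x(2) by blast
    next
      fix c assume "c \<in> (\<lambda>e. e \<inter> V) ` ?K"
      then obtain e where e: "e \<in> \<mu>" "e \<subseteq> axis h" "c = e \<inter> V" by blast
      obtain u v where uv: "e \<inter> V = {u, v}"
        using edge_ends[of e] matching_subset[OF pm] e(1) by (metis subsetD)
      then have u: "u \<in> e" "u \<in> V" by blast+
      then have "u \<in> A" using e(2) by (auto simp: axis_verts_def)
      moreover have "medge \<mu> u = e" by (rule medge_unique[OF pm u(2) e(1) u(1)])
      ultimately show "c \<in> (\<lambda>Q. Q \<inter> A) ` ?P"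
        using axis_matching_edge_orbit[OF pm, of u] e by auto
    qed
    moreover have "inj_on (\<lambda>e. e \<inter> V) ?K"
    proof (rule inj_onI)
      fix e f assume ef: "e \<in> ?K" "f \<in> ?K" "e \<inter> V = f \<inter> V"
      have "e \<in> E" using matching_subset[OF pm] ef(1) by blast
      then obtain u v where "e \<inter> V = {u, v}" using edge_ends by metis
      then have "u \<in> e \<inter> V" "u \<in> f \<inter> V" unfolding ef(3)[symmetric] by simp_all
      then have u: "u \<in> V" "u \<in> e" "u \<in> f" by simp_all
      have "e \<in> \<mu>" "f \<in> \<mu>" using ef by simp_all
      then show "e = f" using medge_unique[OF pm u(1) _ u(2)] medge_unique[OF pm u(1) _ u(3)] by simp
    qed
    moreover have "inj_on (\<lambda>Q. Q \<inter> A) ?P" using inj by (rule inj_on_subset) blast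
    ultimately show ?thesis using card_image[of "\<lambda>Q. Q \<inter> A" ?P] card_image[of "\<lambda>e. e \<inter> V" ?K] by simp
  qed
  ultimately show ?thesis using card_A by simp
qed

lemma prod_weight_halve_axis:
  assumes "finite \<mu>"
  shows "(\<Prod>e\<in>\<mu>. weight G e) = 2 ^ card {e \<in> \<mu>. e \<subseteq> axis h} *
    (\<Prod>e\<in>\<mu>. if e \<subseteq> axis h then weight G e / 2 else weight G e)"
proof -
  have "(2::'a) ^ card {e \<in> \<mu>. e \<subseteq> axis h} = (\<Prod>e\<in>\<mu>. if e \<subseteq> axis h then 2 else 1)"
    using assms by (simp add: prod.If_cases Int_def)
  then show ?thesis
    by (simp flip: prod.distrib) (intro prod.cong; simp)
qed


section \<open>The cut graph\<close>

lemma inj_on_Re_A: "inj_on Re A"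
  using A_eqI by (intro inj_onI)

lemma length_axis_list: "length (axis_list h G) = card A"
  using finite_A card_image[OF inj_on_Re_A] by (simp add: axis_list_def)

lemma set_axis_list: "set (axis_list h G) = A"
proof -
  have "(\<lambda>x. Complex x h) ` Re ` A = A"
    unfolding image_image by (force simp: axis_verts_def axis_def complex_eq_iff)
  then show ?thesis using finite_A by (simp add: axis_list_def)
qed

text \<open>The list is strictly sorted, so exactly the \<open>j\<close> entries before position
  \<open>j\<close> lie to the left. This links the indexing of the \<open>a\<close>- and
  \<open>b\<close>-vertices to parity.\<close>

lemma axis_index_nth:
  assumes j: "j < card A" shows "axis_index (axis_list h G ! j) = j"
proof -
  let ?xs = "sorted_list_of_set (Re ` A)"
  have len: "length ?xs = card A" using finite_A card_image[OF inj_on_Re_A] by simp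
  have lt: "?xs ! i < ?xs ! k \<longleftrightarrow> i < k" if "i < card A" "k < card A" for i k
    using that len strict_sorted_list_of_set[of "Re ` A"]
    by (metis linorder_neqE_nat order_less_asym sorted_wrt_iff_nth_less)
  have "Re ` {z \<in> A. Re z < ?xs ! j} = (!) ?xs ` {..<j}"
  proof (intro equalityI subsetI)
    fix r assume "r \<in> Re ` {z \<in> A. Re z < ?xs ! j}"
    then have r: "r \<in> set ?xs" "r < ?xs ! j" using finite_A by auto
    then obtain i where "i < card A" "r = ?xs ! i" using len by (metis in_set_conv_nth)
    then show "r \<in> (!) ?xs ` {..<j}" using r(2) lt j by auto
  next
    fix r assume "r \<in> (!) ?xs ` {..<j}"
    then obtain i where i: "i < j" "r = ?xs ! i" by blast
    then have "r \<in> set ?xs" "r < ?xs ! j" using len lt j by auto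
    then show "r \<in> Re ` {z \<in> A. Re z < ?xs ! j}" using finite_A by auto
  qed
  moreover have "card (Re ` {z \<in> A. Re z < ?xs ! j}) = card {z \<in> A. Re z < ?xs ! j}"
    using inj_on_Re_A by (intro card_image) (auto intro: inj_on_subset)
  moreover have "inj_on ((!) ?xs) {..<j}" using j len by (intro inj_on_nth) auto
  then have "card ((!) ?xs ` {..<j}) = j" by (simp add: card_image)
  ultimately show ?thesis using j len by (simp add: axis_index_def axis_list_def)
qed

lemma axis_vertex_cases:
  assumes even: "even (card A)" and x: "x \<in> A"
  obtains (a) i where "i \<in> {1..width h G}" "x = a_vert h G i" "even (axis_index x)"
    | (b) i where "i \<in> {1..width h G}" "x = b_vert h G i" "odd (axis_index x)"
proof -
  obtain j where j: "j < card A" "x = axis_list h G ! j"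
    using x set_axis_list length_axis_list by (metis in_set_conv_nth)
  then have idx: "axis_index x = j" using axis_index_nth by simp
  \<comment> \<open>List position \<open>j\<close> belongs to the pair numbered
    \<open>j div 2 + 1\<close>; as \<open>card A\<close> is even, the last pair is complete.\<close>
  have i: "j div 2 + 1 \<in> {1..width h G}" using j(1) even by (auto simp: width_def)
  show thesis
  proof (cases "even j")
    case True
    then have "2 * (j div 2 + 1) - 2 = j" by simp
    then show ?thesis using a[OF i] True j(2) idx by (simp add: a_vert_def)
  next
    case False
    then have "2 * (j div 2 + 1) - 1 = j" by (simp add: odd_two_times_div_two_succ)
    then show ?thesis using b[OF i] False j(2) idx by (simp add: b_vert_def)
  qed
qed

lemma
  assumes i: "i \<in> {1..width h G}"
  shows a_vert_A: "a_vert h G i \<in> A" "even (axis_index (a_vert h G i))"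
    and b_vert_A: "b_vert h G i \<in> A" "odd (axis_index (b_vert h G i))"
proof -
  have lt: "2 * i - 2 < card A" "2 * i - 1 < card A" using i by (auto simp: width_def)
  show "a_vert h G i \<in> A" "b_vert h G i \<in> A"
    using lt nth_mem[of _ "axis_list h G"] by (simp_all add: a_vert_def b_vert_def set_axis_list length_axis_list)
  show "even (axis_index (a_vert h G i))" "odd (axis_index (b_vert h G i))"
    using lt i by (simp_all add: a_vert_def b_vert_def axis_index_nth)
qed

lemma A_colours: "x \<in> A \<Longrightarrow> x \<in> B \<longleftrightarrow> x \<notin> W"
  using bipartition_WB
  by (auto simp: bipartition_def upper_subgraph_def induced_subgraph_def axis_verts_def axis_def)

lemma up_cut_eq:
  assumes even: "even (card A)"
  shows "{a_vert h G i |i. i \<in> {1..width h G} \<and> a_vert h G i \<in> W} \<union>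
    {b_vert h G i |i. i \<in> {1..width h G} \<and> b_vert h G i \<in> B} = up_cut" (is "?L = _")
proof (intro equalityI subsetI)
  fix x assume "x \<in> up_cut"
  then have x: "x \<in> A" "even (axis_index x) \<longleftrightarrow> x \<in> W" by (auto simp: up_cut_def)
  from even x(1) show "x \<in> ?L"
    by (cases rule: axis_vertex_cases) (use x A_colours in blast)+
next
  fix x assume "x \<in> ?L"
  then show "x \<in> up_cut"
    using a_vert_A b_vert_A A_colours by (auto simp: up_cut_def)
qed

lemma low_cut_eq:
  assumes even: "even (card A)"
  shows "{a_vert h G i |i. i \<in> {1..width h G} \<and> a_vert h G i \<in> B} \<union>
    {b_vert h G i |i. i \<in> {1..width h G} \<and> b_vert h G i \<in> W} = low_cut" (is "?L = _")
proof (intro equalityI subsetI)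
  fix x assume "x \<in> low_cut"
  then have x: "x \<in> A" "even (axis_index x) \<longleftrightarrow> x \<notin> W" by (auto simp: low_cut_def)
  from even x(1) show "x \<in> ?L"
    by (cases rule: axis_vertex_cases) (use x A_colours in blast)+
next
  fix x assume "x \<in> ?L"
  then show "x \<in> low_cut"
    using a_vert_A b_vert_A A_colours by (auto simp: low_cut_def)
qed

lemma cut_graph_eq:
  assumes "even (card A)"
  shows "cut_graph h W B G = halve_axis h (cut_below h low_cut (cut_above h up_cut G))"
  unfolding cut_graph_def Let_def up_cut_eq[OF assms] low_cut_eq[OF assms] ..

text \<open>Cutting keeps all vertices, so only the removed edges matter, and a removed edge that
  belongs to \<open>\<mu>\<close> is the matching edge at the vertex where it was cut.\<close>

lemma perfect_matching_cut_graph_iff: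
  assumes "even (card A)"
  shows "perfect_matching (cut_graph h W B G) \<mu> \<longleftrightarrow> \<mu> \<in> good_matchings"
proof -
  have "perfect_matching (cut_graph h W B G) \<mu> \<longleftrightarrow> perfect_matching G \<mu> \<and>
      (\<forall>e\<in>\<mu>. \<not> (e \<inter> up_cut \<noteq> {} \<and> above e) \<and> \<not> (e \<inter> low_cut \<noteq> {} \<and> below e))"
    unfolding cut_graph_eq[OF assms]
    by (auto simp: perfect_matching_def halve_axis_def cut_below_def cut_above_def above_def below_def)
  also have "\<dots> \<longleftrightarrow> perfect_matching G \<mu> \<and> (\<forall>x\<in>A. \<not> bad \<mu> x)"
  proof (intro conj_cong refl iffI ballI)
    fix x assume pm: "perfect_matching G \<mu>" and x: "x \<in> A"
      and ok: "\<forall>e\<in>\<mu>. \<not> (e \<inter> up_cut \<noteq> {} \<and> above e) \<and> \<not> (e \<inter> low_cut \<noteq> {} \<and> below e)"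
    have m: "medge \<mu> x \<in> \<mu>" "x \<in> medge \<mu> x" using medge[OF pm] x by (simp_all add: A_iff)
    show "\<not> bad \<mu> x" using ok[rule_format, OF m(1)] m(2) unfolding bad_def by blast
  next
    fix e assume pm: "perfect_matching G \<mu>" and e: "e \<in> \<mu>" and ok: "\<forall>x\<in>A. \<not> bad \<mu> x"
    have m: "medge \<mu> x = e" if "x \<in> e" "x \<in> A" for x
      using medge_unique[OF pm _ e that(1)] that(2) by (simp add: A_iff)
    have "\<not> above e" if "x \<in> e" "x \<in> up_cut" for x
      using ok[rule_format, of x] m[of x] that by (auto simp: bad_def up_cut_def)
    moreover have "\<not> below e" if "x \<in> e" "x \<in> low_cut" for x
      using ok[rule_format, of x] m[of x] that by (auto simp: bad_def low_cut_def)
    ultimately show "\<not> (e \<inter> up_cut \<noteq> {} \<and> above e) \<and> \<not> (e \<inter> low_cut \<noteq> {} \<and> below e)"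
      by blast
  qed
  finally show ?thesis by (simp add: good_matchings_def)
qed

lemma weight_cut_graph:
  assumes "even (card A)"
  shows "weight (cut_graph h W B G) e = (if e \<subseteq> axis h then weight G e / 2 else weight G e)"
  by (simp add: cut_graph_eq[OF assms] halve_axis_def cut_below_def cut_above_def)

lemma matching_sum_cut_graph:
  assumes even: "even (card A)"
  shows "matching_sum G = 2 ^ width h G * matching_sum (cut_graph h W B G)"
proof -
  let ?w' = "\<lambda>e. if e \<subseteq> axis h then weight G e / 2 else weight G e"
  have "2 ^ card (nonaxis_orbits \<nu>) * (\<Prod>e\<in>\<nu>. weight G e) = 2 ^ width h G * (\<Prod>e\<in>\<nu>. ?w' e)"
    if "\<nu> \<in> good_matchings" for \<nu>
  proof -
    have pm: "perfect_matching G \<nu>" using that by (simp add: good_matchings_def)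
    \<comment> \<open>The exponent splits: one factor 2 for each orbit that can be reflected, and
      one that undoes the halving for each matching edge on the axis.\<close>
    have "width h G = card (nonaxis_orbits \<nu>) + card {e \<in> \<nu>. e \<subseteq> axis h}"
      unfolding width_def card_axis_matching_edges[OF pm, symmetric] by simp
    then show ?thesis
      unfolding prod_weight_halve_axis[OF finite_matching[OF pm]] by (simp add: power_add)
  qed
  then have "matching_sum G = (\<Sum>\<nu>\<in>good_matchings. 2 ^ width h G * (\<Prod>e\<in>\<nu>. ?w' e))"
    unfolding matching_sum_good by (rule sum.cong[OF refl])
  then show ?thesis
    by (simp add: matching_sum_def perfect_matching_cut_graph_iff[OF even] weight_cut_graph[OF even]
        sum_distrib_left)
qed

end

theorem theorem6p2:
  fixes G :: "'w::field_char_0 wgraph" and R :: "complex set" and h :: real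
  assumes "region_with_holes R"
    and "plane_graph G"
    and "embedded_in G R"
    and "turn_bipartite R G"
    and "weighted_symmetric h G"
    and "even (card (axis_verts h G))"
    and "holes_along h R"
  shows "(\<exists>W B. upper_colouring h G W B) \<and>
    (\<forall>W B. upper_colouring h G W B \<longrightarrow>
       matching_sum G = 2 ^ width h G * matching_sum (cut_graph h W B G))"
proof
  interpret symmetric_plane_graph G h
    using assms by unfold_locales
  show "\<exists>W B. upper_colouring h G W B"
    using upper_colouring_exists assms by blast
  show "\<forall>W B. upper_colouring h G W B \<longrightarrow>
      matching_sum G = 2 ^ width h G * matching_sum (cut_graph h W B G)"
  proof (intro allI impI)
    fix W B assume "upper_colouring h G W B"
    then interpret coloured_symmetric_plane_graph G h W B
      by unfold_locales (simp add: upper_colouring_def)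
    show "matching_sum G = 2 ^ width h G * matching_sum (cut_graph h W B G)"
      using matching_sum_cut_graph assms by blast
  qed
qed

end
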